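(* Fix a positive integer $d$, and let $M=M(h)$ be integers with $2\leq M(h)$ and $M(h)=o(h/\log h)$ as $h\to\infty$. Let $(T_h)_{h\geq 1}$ be a sequence of trees where $T_h$ is a balanced $M$-tree of height $h$, and let $r^*=r^*(h):=\sqrt{d}/(2h)$. Then $r^*$ is a sharp threshold for $\mathcal{G}(|T_h|,r,d)$ to contain a copy of $T_h$; that is, for every fixed $\epsilon\in(0,1)$, as $h\to\infty$ the probability that $\mathcal{G}(|T_h|,r,d)$ contains a copy of $T_h$ tends to $0$ whenever $r\leq(1-\epsilon)r^*$ and tends to $1$ whenever $r\geq(1+\epsilon)r^*$.
   Context: The random geometric graph $\mathcal{G}(n,r,d)$ has as vertex set $n$ points sampled independently and uniformly at random from $[0,1]^d$, two vertices being adjacent if their Euclidean distance is at most $r$. $|T|$ denotes the number of vertices of $T$. For a rooted tree, the layer $V_i$ is the set of vertices at graph distance $i$ from the root, the height is the largest $h$ with $V_h$ nonempty, and the children of a vertex in $V_j$ are its neighbours in $V_{j+1}$. Given positive integers $h$ and $(s_i)_{i=1}^h$, the balanced tree over $(s_i)_{i=1}^h$ is the rooted tree of height $h$ in which, for each $i\in\{1,\dots,h\}$, every vertex of $V_{i-1}$ has exactly $s_i$ children. A balanced $M$-tree (of height $h$) is a balanced tree over a sequence $(s_i)_{i=1}^h$ with $s_i\in\{2,\dots,M\}$ for all $i$. *)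

theory Defs
  imports "HOL-Probability.Probability" "HOL-Library.Landau_Symbols"
begin

text \<open>Canonical balanced tree over the sequence s (entries s 1, ..., s h):
  vertices are the words xs of length at most h with xs!i < s (i+1);
  the root is the empty word, and the children of xs are the words xs @ [a].\<close>
definition bal_verts :: "(nat \<Rightarrow> nat) \<Rightarrow> nat \<Rightarrow> nat list set" where
  "bal_verts s h = {xs. length xs \<le> h \<and> (\<forall>i<length xs. xs ! i < s (Suc i))}"

definition bal_edge :: "(nat \<Rightarrow> nat) \<Rightarrow> nat \<Rightarrow> nat list \<Rightarrow> nat list \<Rightarrow> bool" where
  "bal_edge s h xs ys \<longleftrightarrow> xs \<in> bal_verts s h \<and> ys \<in> bal_verts s h \<and>
     ((\<exists>a. ys = xs @ [a]) \<or> (\<exists>a. xs = ys @ [a]))"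

definition balanced_M_seq :: "nat \<Rightarrow> nat \<Rightarrow> (nat \<Rightarrow> nat) \<Rightarrow> bool" where
  "balanced_M_seq M h s \<longleftrightarrow> (\<forall>i\<in>{1..h}. 2 \<le> s i \<and> s i \<le> M)"

definition eucl_dist :: "nat \<Rightarrow> (nat \<Rightarrow> real) \<Rightarrow> (nat \<Rightarrow> real) \<Rightarrow> real" where
  "eucl_dist d x y = sqrt (\<Sum>i<d. (x i - y i)^2)"

definition rgg_space :: "nat \<Rightarrow> nat \<Rightarrow> (nat \<Rightarrow> nat \<Rightarrow> real) measure" where
  "rgg_space d n = PiM {..<n} (\<lambda>_. PiM {..<d} (\<lambda>_. uniform_measure lborel {0..1::real}))"

definition rgg_contains_copy ::
  "nat \<Rightarrow> nat \<Rightarrow> real \<Rightarrow> 'v set \<Rightarrow> ('v \<Rightarrow> 'v \<Rightarrow> bool) \<Rightarrow> (nat \<Rightarrow> nat \<Rightarrow> real) \<Rightarrow> bool" where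
  "rgg_contains_copy d n r V E \<omega> \<longleftrightarrow>
     (\<exists>f. inj_on f V \<and> f ` V \<subseteq> {..<n} \<and>
          (\<forall>u\<in>V. \<forall>v\<in>V. E u v \<longrightarrow> eucl_dist d (\<omega> (f u)) (\<omega> (f v)) \<le> r))"

definition rgg_prob :: "nat \<Rightarrow> nat \<Rightarrow> real \<Rightarrow> 'v set \<Rightarrow> ('v \<Rightarrow> 'v \<Rightarrow> bool) \<Rightarrow> real" where
  "rgg_prob d n r V E =
     measure (rgg_space d n) {\<omega> \<in> space (rgg_space d n). rgg_contains_copy d n r V E \<omega>}"

definition rstar :: "nat \<Rightarrow> nat \<Rightarrow> real" where
  "rstar d h = sqrt (real d) / (2 * real h)"

end

theory Submission
  imports Defs "HOL-Real_Asymp.Real_Asymp"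
begin

text \<open>
  Below the threshold, the graph contains with high probability two points near opposite corners of
  the cube, at distance greater than \<open>2 h r\<close>; since a copy of the tree uses all the points and has
  diameter at most \<open>2 h\<close>, there is none.

  Above the threshold, divide the cube into \<open>m = N^d\<close> cells with \<open>N\<close> a large multiple of \<open>h\<close>, ordered so
  that consecutive cells touch; with high probability each cell contains at least
  \<open>|T_h| / (4 m)\<close> points. Number the tree vertices in preorder and, proportionally to the cell counts,
  give each vertex a target cell. With \<open>k = \<lfloor>\<delta> h\<rfloor>\<close>, the vertices on levels up to \<open>k\<close> are put at the
  centre of the cube; those on levels between \<open>k\<close> and \<open>h - k\<close> move along the segment from the
  centre to their target; the remaining ones lie in their target. A subtree rooted on level \<open>k\<close> and
  the set of vertices above level \<open>h - k\<close> both have fewer vertices than any cell has points. Hence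
  the targets of parent and child below level \<open>k\<close> are equal or consecutive, and this survives
  shifting the targets of the vertices below level \<open>h - k\<close> so as to make the numbers of vertices
  and of points agree exactly in every cell.
\<close>

section \<open>Balanced trees in preorder\<close>

lemma Nil_in_bal_verts [simp]: "[] \<in> bal_verts s h"
  by (simp add: bal_verts_def)

lemma Cons_in_bal_verts_0 [simp]: "a # xs \<notin> bal_verts s 0"
  by (simp add: bal_verts_def)

lemma Cons_in_bal_verts_Suc [simp]:
  "a # xs \<in> bal_verts s (Suc h) \<longleftrightarrow> a < s (Suc 0) \<and> xs \<in> bal_verts (\<lambda>i. s (Suc i)) h"
  by (auto simp: bal_verts_def nth_Cons split: nat.splits)

lemma bal_verts_0 [simp]: "bal_verts s 0 = {[]}"
  by (auto simp: bal_verts_def)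

lemma bal_verts_Suc:
  "bal_verts s (Suc h) =
     insert [] ((\<lambda>(a, xs). a # xs) ` ({..<s (Suc 0)} \<times> bal_verts (\<lambda>i. s (Suc i)) h))"
proof (rule set_eqI)
  fix ys show "ys \<in> bal_verts s (Suc h) \<longleftrightarrow>
    ys \<in> insert [] ((\<lambda>(a, xs). a # xs) ` ({..<s (Suc 0)} \<times> bal_verts (\<lambda>i. s (Suc i)) h))"
    by (cases ys) auto
qed

lemma finite_bal_verts [simp]: "finite (bal_verts s h)"
  by (induction h arbitrary: s) (simp_all add: bal_verts_Suc)

lemma card_bal_verts_Suc:
  "card (bal_verts s (Suc h)) = Suc (s (Suc 0) * card (bal_verts (\<lambda>i. s (Suc i)) h))"
proof -
  have "inj_on (\<lambda>(a, xs). a # xs) ({..<s (Suc 0)} \<times> bal_verts (\<lambda>i. s (Suc i)) h)"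
    by (auto simp: inj_on_def)
  then show ?thesis
    unfolding bal_verts_Suc by (subst card_insert_disjoint) (auto simp: card_image)
qed

lemma card_bal_verts_pos: "0 < card (bal_verts s h)"
  by (simp add: card_gt_0_iff) (metis Nil_in_bal_verts empty_iff)

lemma card_bal_verts_ge:
  assumes "\<forall>i\<in>{1..h}. 2 \<le> s i"
  shows "2 ^ h \<le> card (bal_verts s h)"
  using assms
proof (induction h arbitrary: s)
  case (Suc h)
  have "2 ^ h \<le> card (bal_verts (\<lambda>i. s (Suc i)) h)"
    using Suc.prems by (intro Suc.IH) auto
  moreover have "2 \<le> s (Suc 0)" using Suc.prems by auto
  ultimately have "2 * 2 ^ h \<le> s (Suc 0) * card (bal_verts (\<lambda>i. s (Suc i)) h)"
    by (rule mult_le_mono[rotated])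
  then show ?case by (simp add: card_bal_verts_Suc)
qed auto

section \<open>Preorder numbering of the tree\<close>

text \<open>All subtrees rooted at the children of one vertex have equal size, so skipping the
  \<open>a\<close> subtrees to the left is a multiplication; the leading \<open>Suc\<close> counts
  the parent itself.\<close>

fun preorder_index :: "(nat \<Rightarrow> nat) \<Rightarrow> nat \<Rightarrow> nat list \<Rightarrow> nat" where
  "preorder_index s h [] = 0"
| "preorder_index s h (a # xs) =
     Suc (a * card (bal_verts (\<lambda>i. s (Suc i)) (h - 1)) + preorder_index (\<lambda>i. s (Suc i)) (h - 1) xs)"

lemma preorder_index_less:
  "xs \<in> bal_verts s h \<Longrightarrow> preorder_index s h xs < card (bal_verts s h)"
proof (induction xs arbitrary: s h)
  case (Cons a xs)
  then obtain h' where h: "h = Suc h'" by (cases h) auto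
  let ?c = "card (bal_verts (\<lambda>i. s (Suc i)) h')"
  have a: "a < s (Suc 0)" and "preorder_index (\<lambda>i. s (Suc i)) h' xs < ?c"
    using Cons h by auto
  then have "a * ?c + preorder_index (\<lambda>i. s (Suc i)) h' xs < Suc a * ?c" by simp
  also have "\<dots> \<le> s (Suc 0) * ?c" using a by (intro mult_le_mono1) simp
  finally show ?case by (simp add: h card_bal_verts_Suc)
qed (simp add: card_bal_verts_pos)

lemma inj_on_preorder_index: "inj_on (preorder_index s h) (bal_verts s h)"
proof (rule inj_onI)
  fix xs ys
  assume "xs \<in> bal_verts s h" "ys \<in> bal_verts s h" "preorder_index s h xs = preorder_index s h ys"
  then show "xs = ys"
  proof (induction xs arbitrary: ys s h)
    case Nil then show ?case by (cases ys) auto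
  next
    case (Cons a xs)
    then obtain b zs where ys: "ys = b # zs" by (cases ys) auto
    from Cons obtain h' where h: "h = Suc h'" by (cases h) auto
    let ?s = "\<lambda>i. s (Suc i)"
    let ?c = "card (bal_verts ?s h')"
    have lt: "preorder_index ?s h' xs < ?c" "preorder_index ?s h' zs < ?c"
      using Cons.prems by (auto simp: ys h intro!: preorder_index_less)
    have eq: "a * ?c + preorder_index ?s h' xs = b * ?c + preorder_index ?s h' zs"
      using Cons.prems by (simp add: ys h)
    \<comment> \<open>Division by the common subtree size recovers the first letter, and the
      remainder is the position inside that subtree.\<close>
    have div_less_c: "y < c \<Longrightarrow> (x * c + y) div c = x" for x y c :: nat by simp
    have "(a * ?c + preorder_index ?s h' xs) div ?c = a" "(b * ?c + preorder_index ?s h' zs) div ?c = b"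
      by (rule div_less_c, rule lt)+
    with eq have "a = b" by simp
    with eq have "preorder_index ?s h' xs = preorder_index ?s h' zs" by simp
    with Cons.IH[of ?s h' zs] Cons.prems \<open>a = b\<close> show ?case by (simp add: ys h)
  qed
qed

lemma bij_betw_preorder_index:
  "bij_betw (preorder_index s h) (bal_verts s h) {..<card (bal_verts s h)}"
proof (rule bij_betw_imageI[OF inj_on_preorder_index])
  have "preorder_index s h ` bal_verts s h \<subseteq> {..<card (bal_verts s h)}"
    by (auto intro: preorder_index_less)
  moreover have "card (preorder_index s h ` bal_verts s h) = card (bal_verts s h)"
    by (rule card_image[OF inj_on_preorder_index])
  ultimately show "preorder_index s h ` bal_verts s h = {..<card (bal_verts s h)}"
    by (intro card_subset_eq) auto
qed

lemma preorder_index_le_child: "preorder_index s h xs \<le> preorder_index s h (xs @ [a])"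
  by (induction xs arbitrary: s h) auto

text \<open>Parent and child lie in one subtree rooted on level \<open>k\<close>, which preorder
  lists consecutively. Each level descended at least halves the subtree size, so the index gap is at
  most \<open>card (bal_verts s h) / 2 ^ k\<close>.\<close>

lemma preorder_index_child_diff:
  assumes "xs @ [a] \<in> bal_verts s h" "k \<le> length xs" "\<forall>i\<in>{1..h}. 2 \<le> s i"
  shows "(preorder_index s h (xs @ [a]) - preorder_index s h xs) * 2 ^ k \<le> card (bal_verts s h)"
  using assms
proof (induction xs arbitrary: s h k)
  case Nil
  then show ?case using preorder_index_less[OF Nil(1)] by simp
next
  case (Cons b xs)
  show ?case
  proof (cases k)
    case 0
    then show ?thesis using preorder_index_less[OF Cons.prems(1)] by simp
  next
    case (Suc k')
    from Cons.prems obtain h' where h: "h = Suc h'" by (cases h) auto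
    let ?s = "\<lambda>i. s (Suc i)"
    have "(preorder_index ?s h' (xs @ [a]) - preorder_index ?s h' xs) * 2 ^ k' \<le> card (bal_verts ?s h')"
      using Cons.prems by (intro Cons.IH) (auto simp: h Suc)
    moreover have "2 * card (bal_verts ?s h') \<le> card (bal_verts s h)"
      using Cons.prems(3) by (simp add: h card_bal_verts_Suc le_SucI)
    ultimately show ?thesis by (simp add: h Suc)
  qed
qed

text \<open>Every vertex above level \<open>h - k\<close> can be extended by each of the
  \<open>2 ^ k\<close> binary words of length \<open>k\<close>. Binary letters are always admissible
  because every branching number is at least 2, and the fixed suffix length makes the extensions
  distinct.\<close>

lemma card_top_levels:
  assumes "\<forall>i\<in>{1..h}. 2 \<le> s i" "k \<le> h"
  shows "card {xs \<in> bal_verts s h. length xs < h - k} * 2 ^ k \<le> card (bal_verts s h)"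
proof -
  let ?T = "{xs \<in> bal_verts s h. length xs < h - k}"
  let ?W = "{ws :: nat list. set ws \<subseteq> {0, 1} \<and> length ws = k}"
  have "inj_on (\<lambda>(xs, ws). xs @ ws) (?T \<times> ?W)"
    by (auto simp: inj_on_def)
  then have "card ((\<lambda>(xs, ws). xs @ ws) ` (?T \<times> ?W)) = card ?T * card ?W"
    by (simp add: card_image card_cartesian_product)
  moreover have "card ?W = 2 ^ k"
    using card_lists_length_eq[of "{0, 1 :: nat}" k] by (simp flip: numeral_2_eq_2)
  moreover have "(\<lambda>(xs, ws). xs @ ws) ` (?T \<times> ?W) \<subseteq> bal_verts s h"
  proof safe
    fix xs ws :: "nat list"
    assume xs: "xs \<in> bal_verts s h" "length xs < h - length ws"
      and ws: "set ws \<subseteq> {0, 1}" "k = length ws"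
    have "(xs @ ws) ! i < s (Suc i)" if i: "i < length (xs @ ws)" for i
    proof (cases "i < length xs")
      case True
      then show ?thesis using xs by (auto simp: bal_verts_def nth_append)
    next
      case False
      then have "(xs @ ws) ! i \<in> set ws" using i by (auto simp: nth_append)
      then have "(xs @ ws) ! i < 2" using ws by auto
      also have "2 \<le> s (Suc i)" using i xs(2) assms(1) by auto
      finally show ?thesis .
    qed
    then show "xs @ ws \<in> bal_verts s h" using xs by (auto simp: bal_verts_def)
  qed
  ultimately show ?thesis
    using card_mono[OF finite_bal_verts, of "(\<lambda>(xs, ws). xs @ ws) ` (?T \<times> ?W)" s h] by simp
qed

section \<open>Cutting an interval of positions into blocks\<close>

text \<open>The positions below \<open>sum l {..<m}\<close> are cut into consecutive blocks of
  lengths \<open>l 0\<close>, \<open>l 1\<close>, ...; this is the number of the block that contains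
  \<open>p\<close>. Empty blocks are skipped, and the value is meaningful only for positions below
  the total length.\<close>

definition block_of :: "(nat \<Rightarrow> nat) \<Rightarrow> nat \<Rightarrow> nat" where
  "block_of l p = (LEAST u. p < sum l {..<Suc u})"

lemma block_of:
  assumes "p < sum l {..<m}"
  shows "block_of l p < m" "sum l {..<block_of l p} \<le> p" "p < sum l {..<Suc (block_of l p)}"
proof -
  obtain m' where m: "m = Suc m'" using assms by (cases m) auto
  show "p < sum l {..<Suc (block_of l p)}"
    unfolding block_of_def by (rule LeastI[of _ m']) (use assms m in simp)
  show "block_of l p < m"
    unfolding block_of_def m less_Suc_eq_le by (rule Least_le) (use assms m in simp)
  show "sum l {..<block_of l p} \<le> p"
  proof (cases "block_of l p")
    case (Suc u)
    then show ?thesis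
      unfolding block_of_def by (metis lessI not_less_Least not_le)
  qed simp
qed

lemma sum_lessThan_mono:
  fixes l :: "nat \<Rightarrow> nat"
  shows "u \<le> v \<Longrightarrow> sum l {..<u} \<le> sum l {..<v}"
  by (rule sum_mono2) auto

lemma block_of_eqI:
  assumes "sum l {..<u} \<le> p" "p < sum l {..<Suc u}"
  shows "block_of l p = u"
  unfolding block_of_def
proof (rule Least_equality[of "\<lambda>u. p < sum l {..<Suc u}", OF assms(2)])
  fix v assume "p < sum l {..<Suc v}"
  show "u \<le> v"
  proof (rule ccontr)
    assume "\<not> u \<le> v"
    then have "sum l {..<Suc v} \<le> sum l {..<u}" by (intro sum_lessThan_mono) simp
    with \<open>p < sum l {..<Suc v}\<close> assms(1) show False by simp
  qed
qed

lemma card_block_of: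
  assumes "u < m"
  shows "card {p \<in> {..<sum l {..<m}}. block_of l p = u} = l u"
proof -
  have "{p \<in> {..<sum l {..<m}}. block_of l p = u} = {sum l {..<u}..<sum l {..<Suc u}}" (is "?A = ?B")
  proof
    show "?A \<subseteq> ?B" using block_of(2,3)[of _ l m] by auto
    have "sum l {..<Suc u} \<le> sum l {..<m}" using assms by (intro sum_lessThan_mono) simp
    then show "?B \<subseteq> ?A" using block_of_eqI[of l u] by auto
  qed
  then show ?thesis by simp
qed

text \<open>If the claim failed, a whole block of \<open>c\<close> would separate the two positions.
  Its length is at least \<open>W + P\<close>, where \<open>W\<close> bounds the lead of
  \<open>a\<close> over \<open>b\<close> and \<open>P\<close> bounds how far the prefix sums of
  \<open>A\<close> lag behind those of \<open>c\<close>; the strict inequality for \<open>b\<close>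
  then gives a contradiction.\<close>

lemma block_of_le_Suc:
  assumes A: "\<And>u. u \<le> m \<Longrightarrow> sum c {..<u} \<le> sum A {..<u} + P"
    and B: "\<And>u. u \<le> m \<Longrightarrow> sum B {..<u} \<le> sum c {..<u}"
    and a: "a < sum A {..<m}" and b: "b < sum B {..<m}"
    and "a \<le> b + W" and W: "\<And>u. u < m \<Longrightarrow> W + P \<le> c u"
  shows "block_of A a \<le> Suc (block_of B b)"
proof (rule ccontr)
  define u v where "u = block_of A a" and "v = block_of B b"
  assume "\<not> block_of A a \<le> Suc (block_of B b)"
  then have uv: "Suc (Suc v) \<le> u" by (simp add: u_def v_def)
  have um: "u < m" using block_of[OF a] by (simp add: u_def)
  have "sum c {..<Suc (Suc v)} \<le> sum c {..<u}" using uv by (rule sum_lessThan_mono)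
  also have "\<dots> \<le> sum A {..<u} + P" using A um by simp
  also have "\<dots> \<le> a + P" using block_of[OF a] by (simp add: u_def)
  also have "\<dots> \<le> b + W + P" using assms by simp
  also have "\<dots> < sum B {..<Suc v} + W + P" using block_of[OF b] by (simp add: v_def)
  also have "\<dots> \<le> sum c {..<Suc v} + W + P" using B[of "Suc v"] uv um by simp
  also have "\<dots> \<le> sum c {..<Suc (Suc v)}" using W[of "Suc v"] uv um by simp
  finally show False by simp
qed

section \<open>Assigning tree vertices to cells\<close>

text \<open>Rank is strictly increasing in \<open>g\<close>. This renumbers without gaps the
  vertices that remain once the top levels have been taken out of the preorder.\<close>

lemma bij_betw_rank:
  fixes g :: "'a \<Rightarrow> nat"
  assumes "finite F" "inj_on g F"
  shows "bij_betw (\<lambda>x. card {y \<in> F. g y < g x}) F {..<card F}"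
proof -
  let ?r = "\<lambda>x. card {y \<in> F. g y < g x}"
  have less: "?r x < ?r y" if "x \<in> F" "g x < g y" for x y
    by (rule psubset_card_mono) (use that assms(1) in auto)
  have inj: "inj_on ?r F"
  proof (rule inj_onI)
    fix x y assume "x \<in> F" "y \<in> F" "?r x = ?r y"
    with less[of x y] less[of y x] have "g x = g y" by (metis less_irrefl linorder_neqE_nat)
    with \<open>x \<in> F\<close> \<open>y \<in> F\<close> assms(2) show "x = y" by (auto dest: inj_onD)
  qed
  have "?r ` F \<subseteq> {..<card F}"
    using assms(1) by (auto intro!: psubset_card_mono)
  then have "?r ` F = {..<card F}"
    using card_image[OF inj] by (intro card_subset_eq) auto
  with inj show ?thesis by (simp add: bij_betw_def)
qed

text \<open>Here \<open>\<tau>\<close> is the target cell of a vertex and \<open>\<phi>\<close> the cell it is put in; \<open>place j u\<close> is the cell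
  visited on level \<open>j\<close> on the way to the target \<open>u\<close>.\<close>

lemma bal_verts_cell_assignment:
  fixes s :: "nat \<Rightarrow> nat" and h :: nat and cnt :: "nat \<Rightarrow> nat" and place :: "nat \<Rightarrow> nat \<Rightarrow> nat"
  defines "V \<equiv> bal_verts s h"
  assumes s: "\<forall>i\<in>{1..h}. 2 \<le> s i" and k: "k \<le> h"
    and cnt_sum: "sum cnt {..<m} = card V"
    and cnt_ge: "\<And>u. u < m \<Longrightarrow> 3 * card V \<le> cnt u * 2 ^ k"
    and place: "\<And>j u. u < m \<Longrightarrow> place j u < m"
  obtains \<phi> \<tau> where
    "\<And>xs. xs \<in> V \<Longrightarrow> \<tau> xs < m"
    "\<And>u. u < m \<Longrightarrow> card {xs \<in> V. \<phi> xs = u} = cnt u"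
    "\<And>xs. xs \<in> V \<Longrightarrow> length xs < h - k \<Longrightarrow> \<phi> xs = place (length xs) (\<tau> xs)"
    "\<And>xs. xs \<in> V \<Longrightarrow> h - k \<le> length xs \<Longrightarrow> \<phi> xs = \<tau> xs"
    "\<And>xs a. xs @ [a] \<in> V \<Longrightarrow> k \<le> length xs \<Longrightarrow> \<tau> xs \<le> Suc (\<tau> (xs @ [a])) \<and> \<tau> (xs @ [a]) \<le> Suc (\<tau> xs)"
proof -
  define T where "T = {xs \<in> V. length xs < h - k}"
  define B where "B = {xs \<in> V. h - k \<le> length xs}"
  define P where "P = card T"
  define pre where "pre = preorder_index s h"
  define rk where "rk xs = card {ys \<in> B. pre ys < pre xs}" for xs
  have fin: "finite V" "finite T" "finite B" by (auto simp: V_def T_def B_def)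
  have VTB: "V = T \<union> B" "T \<inter> B = {}" by (auto simp: T_def B_def)
  have cardV: "card V = P + card B" using fin VTB by (simp add: P_def card_Un_disjoint)
  have P: "P * 2 ^ k \<le> card V" unfolding P_def T_def V_def by (rule card_top_levels[OF s k])
  have pre_bij: "bij_betw pre V {..<card V}" unfolding pre_def V_def by (rule bij_betw_preorder_index)
  then have pre_inj: "inj_on pre V" and pre_lt: "\<And>xs. xs \<in> V \<Longrightarrow> pre xs < sum cnt {..<m}"
    by (auto simp: bij_betw_def cnt_sum)
  \<comment> \<open>Provisional targets: the preorder is cut into runs whose lengths are the cell
    counts.\<close>
  define \<tau>1 where "\<tau>1 xs = block_of cnt (pre xs)" for xs
  have \<tau>1: "\<tau>1 xs < m" if "xs \<in> V" for xs
    unfolding \<tau>1_def by (rule block_of) (rule pre_lt[OF that])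
  define \<phi>1 where "\<phi>1 xs = place (length xs) (\<tau>1 xs)" for xs
  define top where "top u = card {xs \<in> T. \<phi>1 xs = u}" for u
  have top_sum: "sum top {..<u} = card {xs \<in> T. \<phi>1 xs < u}" for u
  proof -
    have "sum top {..<u} = card (\<Union>v<u. {xs \<in> T. \<phi>1 xs = v})"
      unfolding top_def by (subst card_UN_disjoint) (auto simp: fin)
    also have "(\<Union>v<u. {xs \<in> T. \<phi>1 xs = v}) = {xs \<in> T. \<phi>1 xs < u}" by auto
    finally show ?thesis .
  qed
  have top_sum_le: "sum top {..<u} \<le> P" for u
    unfolding top_sum P_def by (rule card_mono) (auto simp: fin)
  have top_sum_m: "sum top {..<m} = P"
  proof -
    have "{xs \<in> T. \<phi>1 xs < m} = T" using \<tau>1 place by (auto simp: \<phi>1_def VTB)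
    then show ?thesis by (simp add: top_sum P_def)
  qed
  have top_le: "top u \<le> cnt u" if "u < m" for u
  proof -
    have "top u \<le> P" unfolding top_def P_def by (rule card_mono) (auto simp: fin)
    then have "top u * 2 ^ k \<le> P * 2 ^ k" by simp
    with P cnt_ge[OF that] have "top u * 2 ^ k \<le> cnt u * 2 ^ k" by linarith
    then show ?thesis by simp
  qed
  \<comment> \<open>The room left in each cell after the vertices above level \<open>h - k\<close>
    have been placed; by \<open>top_le\<close> the subtraction is not truncated.\<close>
  define l where "l u = cnt u - top u" for u
  have l_sum: "sum l {..<u} + sum top {..<u} = sum cnt {..<u}" if "u \<le> m" for u
    using top_le that by (auto simp: l_def sum.distrib[symmetric] intro!: sum.cong)
  have cardB: "sum l {..<m} = card B"
    using l_sum[of m] top_sum_m cnt_sum cardV by simp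
  have rk_bij: "bij_betw rk B {..<card B}"
    unfolding rk_def by (rule bij_betw_rank) (auto simp: fin VTB intro: inj_on_subset[OF pre_inj])
  have rk_lt: "rk xs < sum l {..<m}" if "xs \<in> B" for xs
    using rk_bij that by (auto simp: bij_betw_def cardB)
  \<comment> \<open>Since \<open>pre\<close> runs through an initial segment, \<open>pre xs\<close>
    counts all vertices before \<open>xs\<close>, while \<open>rk xs\<close> counts only those in
    \<open>B\<close>. The difference consists of vertices of \<open>T\<close>, of which there are
    \<open>P\<close>.\<close>
  have rk_pre: "rk xs \<le> pre xs" "pre xs \<le> rk xs + P" if "xs \<in> V" for xs
  proof -
    have "pre ` {ys \<in> V. pre ys < pre xs} = {..<pre xs}"
    proof -
      have "pre xs < card V" using pre_lt[OF that] cnt_sum by simp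
      then have "p \<in> pre ` V" if "p < pre xs" for p
        using that pre_bij by (auto simp: bij_betw_def)
      then show ?thesis by auto
    qed
    moreover have "inj_on pre {ys \<in> V. pre ys < pre xs}" by (rule inj_on_subset[OF pre_inj]) auto
    ultimately have "card {ys \<in> V. pre ys < pre xs} = pre xs" by (metis card_image card_lessThan)
    moreover have "{ys \<in> V. pre ys < pre xs} = {ys \<in> T. pre ys < pre xs} \<union> {ys \<in> B. pre ys < pre xs}"
      by (auto simp: VTB)
    moreover have "card \<dots> = card {ys \<in> T. pre ys < pre xs} + rk xs"
      unfolding rk_def by (rule card_Un_disjoint) (use fin VTB in auto)
    moreover have "card {ys \<in> T. pre ys < pre xs} \<le> P"
      unfolding P_def by (rule card_mono) (auto simp: fin)
    ultimately show "rk xs \<le> pre xs" "pre xs \<le> rk xs + P" by auto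
  qed
  \<comment> \<open>The lowest levels are retargeted by rank into the leftover capacities, which
    makes every cell count exact.\<close>
  define \<tau> where "\<tau> xs = (if length xs < h - k then \<tau>1 xs else block_of l (rk xs))" for xs
  define \<phi> where "\<phi> xs = (if length xs < h - k then \<phi>1 xs else \<tau> xs)" for xs
  have \<tau>_lt: "\<tau> xs < m" if "xs \<in> V" for xs
    using that \<tau>1 block_of(1)[OF rk_lt] by (auto simp: \<tau>_def B_def)
  have count: "card {xs \<in> V. \<phi> xs = u} = cnt u" if u: "u < m" for u
  proof -
    have "bij_betw rk {xs \<in> B. block_of l (rk xs) = u} {p \<in> {..<card B}. block_of l p = u}"
    proof (rule bij_betw_subset[OF rk_bij])
      have "rk ` B = {..<card B}" using rk_bij by (simp add: bij_betw_def)
      then show "rk ` {xs \<in> B. block_of l (rk xs) = u} = {p \<in> {..<card B}. block_of l p = u}"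
        by auto
    qed auto
    then have "card {xs \<in> B. block_of l (rk xs) = u} = l u"
      using card_block_of[OF u, of l] by (simp add: bij_betw_same_card cardB)
    moreover have "{xs \<in> V. \<phi> xs = u} = {xs \<in> T. \<phi>1 xs = u} \<union> {xs \<in> B. block_of l (rk xs) = u}"
      by (auto simp: \<phi>_def \<tau>_def T_def B_def)
    moreover have "card \<dots> = top u + card {xs \<in> B. block_of l (rk xs) = u}"
      unfolding top_def by (rule card_Un_disjoint) (use fin VTB in auto)
    ultimately show ?thesis using top_le[OF u] by (simp add: l_def)
  qed
  have close: "\<tau> xs \<le> Suc (\<tau> (xs @ [a])) \<and> \<tau> (xs @ [a]) \<le> Suc (\<tau> xs)"
    if "xs @ [a] \<in> V" "k \<le> length xs" for xs a
  proof -
    define ys where "ys = xs @ [a]"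
    define D where "D = pre ys - pre xs"
    have ys: "ys \<in> V" using that by (simp add: ys_def)
    have xs: "xs \<in> V" using that by (auto simp: V_def bal_verts_def nth_append split: if_splits)
    have mono: "pre xs \<le> pre ys" by (simp add: ys_def pre_def preorder_index_le_child)
    have "D * 2 ^ k \<le> card V"
      using preorder_index_child_diff[of xs a s h k] that s by (simp add: D_def ys_def pre_def V_def)
    \<comment> \<open>Each of the three summands is at most \<open>card V / 2 ^ k\<close>, whence
      the factor 3 in \<open>cnt_ge\<close>. \<open>D\<close> is the preorder gap of the edge, one
      \<open>P\<close> pays for replacing preorder by rank, the other for replacing
      \<open>cnt\<close> by \<open>l\<close>.\<close>
    have W: "(D + P) + P \<le> cnt u" if "u < m" for u
    proof -
      have "((D + P) + P) * 2 ^ k \<le> cnt u * 2 ^ k"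
        unfolding add_mult_distrib using P \<open>D * 2 ^ k \<le> card V\<close> cnt_ge[OF that] by linarith
      then show ?thesis by simp
    qed
    \<comment> \<open>Both kinds of target are block numbers, so one argument covers edges inside
      either range of levels and edges across level \<open>h - k\<close>.\<close>
    define w where "w zs = (if length zs < h - k then pre zs else rk zs)" for zs
    define C where "C zs = (if length zs < h - k then cnt else l)" for zs :: "nat list"
    have \<tau>w: "\<tau> zs = block_of (C zs) (w zs)" for zs by (simp add: \<tau>_def C_def w_def \<tau>1_def)
    have wlt: "w zs < sum (C zs) {..<m}" if "zs \<in> V" for zs
      using that pre_lt rk_lt by (auto simp: w_def C_def B_def)
    have C: "sum cnt {..<u} \<le> sum (C zs) {..<u} + P" "sum (C zs) {..<u} \<le> sum cnt {..<u}" if "u \<le> m" for u zs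
      using l_sum[OF that] top_sum_le[of u] by (auto simp: C_def)
    have ww: "w xs \<le> w ys + (D + P)" "w ys \<le> w xs + (D + P)"
      using rk_pre[OF xs] rk_pre[OF ys] mono by (auto simp: w_def D_def ys_def)
    have "\<tau> xs \<le> Suc (\<tau> ys)"
      unfolding \<tau>w by (rule block_of_le_Suc[OF C wlt wlt ww(1) W]) (use xs ys in auto)
    moreover have "\<tau> ys \<le> Suc (\<tau> xs)"
      unfolding \<tau>w by (rule block_of_le_Suc[OF C wlt wlt ww(2) W]) (use xs ys in auto)
    ultimately show ?thesis by (simp add: ys_def)
  qed
  show thesis
    by (rule that[of \<tau> \<phi>, OF \<tau>_lt count _ _ close]) (auto simp: \<phi>_def \<phi>1_def \<tau>_def)
qed

section \<open>Embedding into a cube with well-filled cells\<close>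

text \<open>A triangle wave: it counts up from \<open>0\<close> to \<open>N - 1\<close> and then
  down again, repeating the value at each turn, so it has no jump where \<open>b mod N\<close> drops
  to zero.\<close>

definition zigzag :: "nat \<Rightarrow> nat \<Rightarrow> nat" where
  "zigzag N b = (if even (b div N) then b mod N else N - 1 - b mod N)"

text \<open>The cells of the grid \<open>{0..<N}^d\<close> are enumerated by the reflected base-\<open>N\<close> Gray code.\<close>

definition snake :: "nat \<Rightarrow> nat \<Rightarrow> nat \<Rightarrow> nat" where
  "snake N u i = zigzag N (u div N ^ i)"

lemma zigzag_less: "0 < N \<Longrightarrow> zigzag N b < N"
  by (auto simp: zigzag_def)

lemma zigzag_Suc: "0 < N \<Longrightarrow> \<bar>real (zigzag N (Suc b)) - real (zigzag N b)\<bar> \<le> 1"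
proof -
  assume N: "0 < N"
  have "b mod N < N" using N by simp
  then show ?thesis
    using N by (auto simp: zigzag_def mod_Suc div_Suc of_nat_diff)
qed

text \<open>Each quotient \<open>u div N ^ i\<close> grows by at most one, so the bound for
  \<open>zigzag\<close> applies in every coordinate separately.\<close>

lemma snake_Suc: "0 < N \<Longrightarrow> \<bar>real (snake N (Suc u) i) - real (snake N u i)\<bar> \<le> 1"
  unfolding snake_def by (subst div_Suc) (simp add: zigzag_Suc)

text \<open>Decoding starts with the higher digits: coordinates from 1 on determine
  \<open>u div N\<close> by induction, and coordinate 0 then determines
  \<open>u mod N\<close>.\<close>

lemma snake_ex1:
  assumes "0 < N" "\<And>i. i < d \<Longrightarrow> x i < N"
  shows "\<exists>!u. u < N ^ d \<and> (\<forall>i<d. snake N u i = x i)"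
  using assms(2)
proof (induction d arbitrary: x)
  case (Suc d)
  have "\<exists>!v. v < N ^ d \<and> (\<forall>i<d. snake N v i = x (Suc i))"
    by (rule Suc.IH) (use Suc.prems in auto)
  then obtain v where v: "v < N ^ d" "\<forall>i<d. snake N v i = x (Suc i)"
    and uniq: "\<And>w. w < N ^ d \<Longrightarrow> \<forall>i<d. snake N w i = x (Suc i) \<Longrightarrow> w = v" by auto
  \<comment> \<open>The parity of the higher part tells in which direction the lowest digit is
    read.\<close>
  define e where "e = (if even v then x 0 else N - 1 - x 0)"
  have x0: "x 0 < N" using Suc.prems by simp
  have e: "e < N" using x0 by (auto simp: e_def)
  have char: "(u < N ^ Suc d \<and> (\<forall>i<Suc d. snake N u i = x i)) \<longleftrightarrow> u div N = v \<and> u mod N = e" for u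
  proof -
    have "u < N ^ Suc d \<longleftrightarrow> u div N < N ^ d"
      using assms(1) by (simp add: div_less_iff_less_mult mult.commute)
    moreover have "snake N u (Suc i) = snake N (u div N) i" for i
      by (simp add: snake_def div_mult2_eq)
    moreover have "snake N u 0 = x 0 \<longleftrightarrow> u mod N = (if even (u div N) then x 0 else N - 1 - x 0)"
    proof -
      define y where "y = u mod N"
      have "y < N" using assms(1) by (simp add: y_def)
      then show ?thesis
        unfolding y_def[symmetric] using x0 by (auto simp: snake_def zigzag_def simp flip: y_def)
    qed
    ultimately have "(u < N ^ Suc d \<and> (\<forall>i<Suc d. snake N u i = x i)) \<longleftrightarrow>
        (u div N < N ^ d \<and> (\<forall>i<d. snake N (u div N) i = x (Suc i))) \<and>
        u mod N = (if even (u div N) then x 0 else N - 1 - x 0)"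
      unfolding All_less_Suc2 by (simp only:) blast
    also have "u div N < N ^ d \<and> (\<forall>i<d. snake N (u div N) i = x (Suc i)) \<longleftrightarrow> u div N = v"
      using v uniq[of "u div N"] by auto
    finally show ?thesis by (auto simp: e_def)
  qed
  show ?case unfolding char
  proof (rule ex1I[of _ "v * N + e"])
    show "(v * N + e) div N = v \<and> (v * N + e) mod N = e" using e by simp
  next
    fix u assume "u div N = v \<and> u mod N = e"
    then show "u = v * N + e" using div_mult_mod_eq[of u N] by simp
  qed
qed auto

text \<open>Half-open cells, so that they partition the half-open unit cube without
  overlaps.\<close>

definition in_cell :: "nat \<Rightarrow> nat \<Rightarrow> nat \<Rightarrow> (nat \<Rightarrow> real) \<Rightarrow> bool" where
  "in_cell N d u x \<longleftrightarrow> (\<forall>i<d. real (snake N u i) / real N \<le> x i \<and> x i < (real (snake N u i) + 1) / real N)"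

text \<open>Scaling by \<open>N\<close> and rounding down turns membership in a cell into a
  prescribed grid position, which \<open>snake_ex1\<close> decodes.\<close>

lemma in_cell_ex1:
  assumes N: "0 < N" and x: "\<forall>i<d. 0 \<le> x i \<and> x i < 1"
  shows "\<exists>!u. u < N ^ d \<and> in_cell N d u x"
proof -
  define z where "z i = nat \<lfloor>real N * x i\<rfloor>" for i
  have "z i < N" if "i < d" for i
  proof -
    have "0 \<le> real N * x i" using x that by simp
    moreover have "real N * x i < real N" using x that N by simp
    ultimately show ?thesis by (simp add: z_def floor_less_iff nat_less_iff)
  qed
  then have "\<exists>!u. u < N ^ d \<and> (\<forall>i<d. snake N u i = z i)" by (rule snake_ex1[OF N])
  moreover have "in_cell N d u x \<longleftrightarrow> (\<forall>i<d. snake N u i = z i)" for u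
  proof -
    have "(real (snake N u i) / real N \<le> x i \<and> x i < (real (snake N u i) + 1) / real N)
        \<longleftrightarrow> snake N u i = z i" if "i < d" for i
    proof -
      have "(real (snake N u i) / real N \<le> x i \<and> x i < (real (snake N u i) + 1) / real N)
          \<longleftrightarrow> \<lfloor>real N * x i\<rfloor> = int (snake N u i)"
        using N by (auto simp: floor_eq_iff field_simps)
      moreover have "0 \<le> \<lfloor>real N * x i\<rfloor>" using x that by simp
      ultimately show ?thesis by (auto simp: z_def)
    qed
    then show ?thesis by (auto simp: in_cell_def)
  qed
  ultimately show ?thesis by simp
qed

definition cell_center :: "nat \<Rightarrow> nat \<Rightarrow> nat \<Rightarrow> real" where
  "cell_center N u i = (real (snake N u i) + 1 / 2) / real N"

lemma in_cell_center: "0 < N \<Longrightarrow> in_cell N d u (cell_center N u)"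
  by (auto simp: in_cell_def cell_center_def divide_simps)

lemma cell_center_bounds: "0 < N \<Longrightarrow> 0 < cell_center N u i \<and> cell_center N u i < 1"
proof -
  assume N: "0 < N"
  then have "snake N u i < N" by (simp add: snake_def zigzag_less)
  then have "real (snake N u i) + 1 \<le> real N" by linarith
  then show ?thesis using N by (simp add: cell_center_def add_nonneg_pos)
qed

lemma in_cell_dist:
  assumes "in_cell N d u x" "in_cell N d u y" "i < d"
  shows "\<bar>x i - y i\<bar> \<le> 1 / real N"
  using assms unfolding in_cell_def add_divide_distrib by (smt (verit))

lemma cell_center_dist:
  assumes "0 < N" "u \<le> Suc v" "v \<le> Suc u"
  shows "\<bar>cell_center N u i - cell_center N v i\<bar> \<le> 1 / real N"
proof -
  have "u = v \<or> u = Suc v \<or> v = Suc u" using assms by linarith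
  then have "\<bar>real (snake N u i) - real (snake N v i)\<bar> \<le> 1"
    using snake_Suc[OF assms(1), of v i] snake_Suc[OF assms(1), of u i] by auto
  moreover have "\<bar>cell_center N u i - cell_center N v i\<bar> = \<bar>real (snake N u i) - real (snake N v i)\<bar> / real N"
    by (simp add: cell_center_def flip: diff_divide_distrib)
  ultimately show ?thesis by (simp add: divide_right_mono)
qed

section \<open>From cell assignments to embeddings\<close>

text \<open>Glues arbitrary bijections between fibres of equal size. It turns matching numbers of
  vertices and points in every cell into an embedding.\<close>

lemma bij_betw_fibers:
  assumes "finite A" "finite B" "\<And>a. a \<in> A \<Longrightarrow> f a \<in> I" "\<And>b. b \<in> B \<Longrightarrow> g b \<in> I"
    and card: "\<And>u. u \<in> I \<Longrightarrow> card {a \<in> A. f a = u} = card {b \<in> B. g b = u}"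
  obtains p where "bij_betw p A B" "\<And>a. a \<in> A \<Longrightarrow> g (p a) = f a"
proof -
  have "\<exists>q. bij_betw q {a \<in> A. f a = u} {b \<in> B. g b = u}" if "u \<in> I" for u
    using assms card[OF that] by (intro finite_same_card_bij) auto
  then obtain q where q: "\<And>u. u \<in> I \<Longrightarrow> bij_betw (q u) {a \<in> A. f a = u} {b \<in> B. g b = u}"
    by metis
  define p where "p a = q (f a) a" for a
  have p: "p a \<in> B \<and> g (p a) = f a" if "a \<in> A" for a
    using bij_betwE[OF q[OF assms(3)[OF that]]] that by (auto simp: p_def)
  have "inj_on p A"
  proof (rule inj_onI)
    fix a a' assume a: "a \<in> A" "a' \<in> A" "p a = p a'"
    then have "f a = f a'" using p by metis
    then show "a = a'"
      using q[OF assms(3)[OF a(1)]] a by (auto simp: bij_betw_def p_def dest: inj_onD)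
  qed
  moreover have "b \<in> p ` A" if b: "b \<in> B" for b
  proof -
    have "b \<in> q (g b) ` {a \<in> A. f a = g b}"
      using q[OF assms(4)[OF b]] b by (auto simp: bij_betw_def)
    then obtain a where "b = q (g b) a" "a \<in> A" "f a = g b" by auto
    then show ?thesis by (intro image_eqI[of _ _ a]) (simp_all add: p_def)
  qed
  ultimately have "bij_betw p A B" using p by (auto simp: bij_betw_def)
  with p show thesis by (intro that[of p]) auto
qed

lemma eucl_dist_le:
  assumes "\<And>i. i < d \<Longrightarrow> \<bar>x i - y i\<bar> \<le> c" "0 \<le> c"
  shows "eucl_dist d x y \<le> sqrt (real d) * c"
proof -
  have "(\<Sum>i<d. (x i - y i)^2) \<le> (\<Sum>i<d. c^2)"
    using assms by (intro sum_mono) (auto simp: abs_le_square_iff[symmetric])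
  then have "eucl_dist d x y \<le> sqrt (real d * c^2)"
    by (simp add: eucl_dist_def)
  then show ?thesis using assms by (simp add: real_sqrt_mult)
qed

lemma eucl_dist_commute: "eucl_dist d x y = eucl_dist d y x"
  by (simp add: eucl_dist_def power2_commute)

text \<open>Along an edge each coordinate changes by at most
  \<open>1 / (2 * (real h - 2 * real k))\<close> for the move on the segment from the cube's centre,
  plus three times \<open>1 / real N\<close>: once for the change of target and once at each end for
  the position of the sample point within its cell.\<close>

lemma contains_copy_of_cell_counts:
  fixes s :: "nat \<Rightarrow> nat" and h n k N d :: nat and \<omega> :: "nat \<Rightarrow> nat \<Rightarrow> real"
  assumes N: "0 < N" and s: "\<forall>i\<in>{1..h}. 2 \<le> s i" and k: "2 * k < h"
    and n: "n = card (bal_verts s h)"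
    and cube: "\<And>j. j < n \<Longrightarrow> \<forall>i<d. 0 \<le> \<omega> j i \<and> \<omega> j i < 1"
    and cnt: "\<And>u. u < N ^ d \<Longrightarrow> 3 * n \<le> card {j \<in> {..<n}. in_cell N d u (\<omega> j)} * 2 ^ k"
    and r: "sqrt (real d) * (1 / (2 * (real h - 2 * real k)) + 3 / real N) \<le> r"
  shows "rgg_contains_copy d n r (bal_verts s h) (bal_edge s h) \<omega>"
proof -
  define V where "V = bal_verts s h"
  define m where "m = N ^ d"
  define cell where "cell x = (THE u. u < m \<and> in_cell N d u x)" for x
  have cell: "cell x < m \<and> in_cell N d (cell x) x" if "\<forall>i<d. 0 \<le> x i \<and> x i < 1" for x
    unfolding cell_def m_def using theI'[OF in_cell_ex1[OF N that]] by simp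
  have cell_eq: "cell x = u \<longleftrightarrow> in_cell N d u x"
    if x01: "\<forall>i<d. 0 \<le> x i \<and> x i < 1" and "u < m" for x u
  proof
    assume "cell x = u"
    then show "in_cell N d u x" using cell[OF x01] by simp
  next
    assume "in_cell N d u x"
    with \<open>u < m\<close> have "u < N ^ d \<and> in_cell N d u x" by (simp add: m_def)
    then show "cell x = u"
      unfolding cell_def m_def by (rule the1_equality[OF in_cell_ex1[OF N x01]])
  qed
  define c where "c u = card {j \<in> {..<n}. cell (\<omega> j) = u}" for u
  have c_ge: "3 * card V \<le> c u * 2 ^ k" if "u < m" for u
  proof -
    have "{j \<in> {..<n}. cell (\<omega> j) = u} = {j \<in> {..<n}. in_cell N d u (\<omega> j)}"
      using cell_eq[OF cube] that by auto
    then show ?thesis using cnt[of u] that by (simp add: c_def m_def n V_def)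
  qed
  have c_sum: "sum c {..<m} = card V"
  proof -
    have "sum c {..<m} = card (\<Union>u<m. {j \<in> {..<n}. cell (\<omega> j) = u})"
      unfolding c_def by (subst card_UN_disjoint) auto
    also have "(\<Union>u<m. {j \<in> {..<n}. cell (\<omega> j) = u}) = {..<n}" using cell[OF cube] by auto
    finally show ?thesis by (simp add: n V_def)
  qed
  \<comment> \<open>Fraction of the way travelled on level \<open>j\<close>: 0 up to level
    \<open>k\<close>, 1 from level \<open>h - k\<close> on, linear in between.\<close>
  define lam where "lam j = max 0 (min 1 ((real j - real k) / (real h - 2 * real k)))" for j :: nat
  have lam01: "0 \<le> lam j" "lam j \<le> 1" for j by (auto simp: lam_def)
  have L: "0 < real h - 2 * real k" using k by linarith
  have lam0: "lam j = 0" if "j \<le> k" for j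
    using that L by (auto simp: lam_def divide_nonpos_pos min_def)
  have lam1: "lam j = 1" if "h - k \<le> j" for j
  proof -
    have "real h - 2 * real k \<le> real j - real k" using that k by linarith
    then show ?thesis using L by (simp add: lam_def)
  qed
  have lam_Suc: "\<bar>lam (Suc j) - lam j\<bar> \<le> 1 / (real h - 2 * real k)" for j
  proof -
    have "(real (Suc j) - real k) / (real h - 2 * real k)
        = (real j - real k) / (real h - 2 * real k) + 1 / (real h - 2 * real k)"
      by (simp add: add_divide_distrib[symmetric])
    moreover have "0 \<le> 1 / (real h - 2 * real k)" using L by simp
    ultimately show ?thesis unfolding lam_def by linarith
  qed
  define pt where "pt j u i = 1 / 2 + lam j * (cell_center N u i - 1 / 2)" for j u i
  have pt: "\<forall>i<d. 0 \<le> pt j u i \<and> pt j u i < 1" for j u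
  proof (intro allI impI)
    fix i
    have cb: "\<bar>cell_center N u i - 1 / 2\<bar> < 1 / 2" using cell_center_bounds[OF N, of u i] by linarith
    have "\<bar>lam j * (cell_center N u i - 1 / 2)\<bar> \<le> 1 * \<bar>cell_center N u i - 1 / 2\<bar>"
      unfolding abs_mult using lam01[of j] by (intro mult_right_mono) auto
    then have "\<bar>lam j * (cell_center N u i - 1 / 2)\<bar> < 1 / 2" using cb by (simp only: mult_1)
    moreover have "\<bar>t\<bar> < 1 / 2 \<Longrightarrow> 0 \<le> 1 / 2 + t \<and> 1 / 2 + t < 1" for t :: real by linarith
    ultimately show "0 \<le> pt j u i \<and> pt j u i < 1" unfolding pt_def by blast
  qed
  have kh: "k \<le> h" using k by simp
  obtain \<phi> \<tau> where \<tau>: "\<And>xs. xs \<in> V \<Longrightarrow> \<tau> xs < m"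
    and \<phi>_card: "\<And>u. u < m \<Longrightarrow> card {xs \<in> V. \<phi> xs = u} = c u"
    and \<phi>_top: "\<And>xs. xs \<in> V \<Longrightarrow> length xs < h - k \<Longrightarrow> \<phi> xs = cell (pt (length xs) (\<tau> xs))"
    and \<phi>_bot: "\<And>xs. xs \<in> V \<Longrightarrow> h - k \<le> length xs \<Longrightarrow> \<phi> xs = \<tau> xs"
    and \<tau>_edge: "\<And>xs a. xs @ [a] \<in> V \<Longrightarrow> k \<le> length xs \<Longrightarrow>
        \<tau> xs \<le> Suc (\<tau> (xs @ [a])) \<and> \<tau> (xs @ [a]) \<le> Suc (\<tau> xs)"
  proof (rule bal_verts_cell_assignment[OF s kh c_sum[unfolded V_def] c_ge[unfolded V_def],
        where place = "\<lambda>j u. cell (pt j u)"])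
    show "cell (pt j u) < m" for j u using cell[OF pt] by blast
  qed (unfold V_def, blast+)
  \<comment> \<open>On the lowest levels \<open>pt\<close> is the centre of the target cell, so a
    single description of the occupied cell holds on all levels.\<close>
  have \<phi>: "\<phi> xs < m" "in_cell N d (\<phi> xs) (pt (length xs) (\<tau> xs))" if "xs \<in> V" for xs
  proof -
    have "\<phi> xs < m \<and> in_cell N d (\<phi> xs) (pt (length xs) (\<tau> xs))"
    proof (cases "length xs < h - k")
      case True
      then show ?thesis using \<phi>_top[OF that] cell[OF pt] by simp
    next
      case False
      then have "pt (length xs) (\<tau> xs) = cell_center N (\<tau> xs)" by (simp add: pt_def lam1 fun_eq_iff)
      with False show ?thesis using \<phi>_bot[OF that] \<tau>[OF that] in_cell_center[OF N] by simp
    qed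
    then show "\<phi> xs < m" "in_cell N d (\<phi> xs) (pt (length xs) (\<tau> xs))" by auto
  qed
  obtain f where f: "bij_betw f V {..<n}" "\<And>xs. xs \<in> V \<Longrightarrow> cell (\<omega> (f xs)) = \<phi> xs"
  proof (rule bij_betw_fibers[of V "{..<n}" \<phi> "{..<m}" "\<lambda>j. cell (\<omega> j)"])
    show "card {a \<in> V. \<phi> a = u} = card {b \<in> {..<n}. cell (\<omega> b) = u}" if "u \<in> {..<m}" for u
      using that \<phi>_card by (simp add: c_def)
  qed (use \<phi> cell[OF cube] in \<open>auto simp: V_def\<close>)
  have near: "\<bar>\<omega> (f xs) i - pt (length xs) (\<tau> xs) i\<bar> \<le> 1 / real N" if "xs \<in> V" "i < d" for xs i
  proof -
    have "f xs < n" using f(1) that by (auto simp: bij_betw_def)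
    then have "in_cell N d (\<phi> xs) (\<omega> (f xs))" using cell[OF cube] f(2)[OF that(1)] by metis
    then show ?thesis using \<phi>(2)[OF that(1)] that(2) by (rule in_cell_dist)
  qed
  have pt_edge: "\<bar>pt (length xs) (\<tau> xs) i - pt (Suc (length xs)) (\<tau> (xs @ [a])) i\<bar>
      \<le> 1 / (2 * (real h - 2 * real k)) + 1 / real N" if "xs @ [a] \<in> V" for xs a i
  proof (cases "k \<le> length xs")
    case False
    \<comment> \<open>Both ends still sit at the cube's centre, so it does not matter that their
      targets may be far apart.\<close>
    then have "lam (length xs) = 0" "lam (Suc (length xs)) = 0" by (simp_all add: lam0)
    then show ?thesis using L by (simp add: pt_def)
  next
    case True
    define x y where "x = cell_center N (\<tau> xs) i" and "y = cell_center N (\<tau> (xs @ [a])) i"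
    define p q where "p = lam (length xs)" and "q = lam (Suc (length xs))"
    \<comment> \<open>The first term is progress towards a fixed target, whose coordinates are
      within 1/2 of the centre; the second is the change of target.\<close>
    have "pt (length xs) (\<tau> xs) i - pt (Suc (length xs)) (\<tau> (xs @ [a])) i = (p - q) * (x - 1 / 2) + q * (x - y)"
      by (simp add: pt_def x_def y_def p_def q_def algebra_simps)
    moreover have "\<bar>(p - q) * (x - 1 / 2)\<bar> \<le> 1 / (2 * (real h - 2 * real k))"
    proof -
      have "\<bar>p - q\<bar> \<le> 1 / (real h - 2 * real k)"
        using lam_Suc[of "length xs"] by (simp add: p_def q_def abs_minus_commute)
      moreover have "\<bar>x - 1 / 2\<bar> \<le> 1 / 2"
        using cell_center_bounds[OF N, of "\<tau> xs" i] unfolding x_def by linarith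
      ultimately have "\<bar>p - q\<bar> * \<bar>x - 1 / 2\<bar> \<le> 1 / (real h - 2 * real k) * (1 / 2)"
        using L by (intro mult_mono) auto
      then show ?thesis by (simp add: abs_mult mult.commute)
    qed
    moreover have "\<bar>q * (x - y)\<bar> \<le> 1 * (1 / real N)"
      unfolding abs_mult using lam01[of "Suc (length xs)"] \<tau>_edge[OF that True]
      by (intro mult_mono) (auto simp: q_def x_def y_def intro!: cell_center_dist[OF N])
    ultimately show ?thesis by (simp only: mult_1)
  qed
  have edge: "eucl_dist d (\<omega> (f xs)) (\<omega> (f (xs @ [a]))) \<le> r"
    if "xs \<in> V" "xs @ [a] \<in> V" for xs a
  proof -
    have "\<bar>\<omega> (f xs) i - \<omega> (f (xs @ [a])) i\<bar> \<le> 1 / (2 * (real h - 2 * real k)) + 3 / real N" if "i < d" for i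
    proof -
      have "3 / real N = 1 / real N + 1 / real N + 1 / real N" by simp
      moreover have "\<bar>\<omega> (f (xs @ [a])) i - pt (Suc (length xs)) (\<tau> (xs @ [a])) i\<bar> \<le> 1 / real N"
        using near[OF \<open>xs @ [a] \<in> V\<close> that] by simp
      ultimately show ?thesis
        using near[OF \<open>xs \<in> V\<close> that] pt_edge[OF \<open>xs @ [a] \<in> V\<close>, of i] by linarith
    qed
    then have "eucl_dist d (\<omega> (f xs)) (\<omega> (f (xs @ [a])))
        \<le> sqrt (real d) * (1 / (2 * (real h - 2 * real k)) + 3 / real N)"
      using L by (intro eucl_dist_le) auto
    with r show ?thesis by simp
  qed
  show ?thesis
    unfolding rgg_contains_copy_def V_def[symmetric]
  proof (intro exI conjI ballI impI)
    show "inj_on f V" "f ` V \<subseteq> {..<n}" using f(1) by (auto simp: bij_betw_def)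
    fix xs ys assume "xs \<in> V" "ys \<in> V" "bal_edge s h xs ys"
    then show "eucl_dist d (\<omega> (f xs)) (\<omega> (f ys)) \<le> r"
      unfolding bal_edge_def using edge by (metis eucl_dist_commute)
  qed
qed

section \<open>Probability bounds\<close>

abbreviation unit_interval_measure :: "real measure" where
  "unit_interval_measure \<equiv> uniform_measure lborel {0..1}"

lemma prob_space_unit_interval_measure: "prob_space unit_interval_measure"
  by (rule prob_space_uniform_measure) auto

abbreviation cube_measure :: "nat \<Rightarrow> (nat \<Rightarrow> real) measure" where
  "cube_measure d \<equiv> PiM {..<d} (\<lambda>_. unit_interval_measure)"

lemma prob_space_cube_measure: "prob_space (cube_measure d)"
  by (rule prob_space_PiM) (rule prob_space_unit_interval_measure)

lemma prob_space_rgg_space: "prob_space (rgg_space d n)"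
  unfolding rgg_space_def by (rule prob_space_PiM) (rule prob_space_cube_measure)

text \<open>Half-open on the right, to agree with \<open>in_cell\<close>.\<close>

definition box_event :: "nat \<Rightarrow> (nat \<Rightarrow> real) \<Rightarrow> (nat \<Rightarrow> real) \<Rightarrow> (nat \<Rightarrow> real) set" where
  "box_event d a b = {x \<in> space (cube_measure d). \<forall>i\<in>{..<d}. x i \<in> {a i..<b i}}"

lemma sets_box_event [measurable]: "box_event d a b \<in> sets (cube_measure d)"
  unfolding box_event_def by measurable

lemma measure_box_event:
  assumes "\<And>i. i < d \<Longrightarrow> 0 \<le> a i \<and> a i \<le> b i \<and> b i \<le> 1"
  shows "measure (cube_measure d) (box_event d a b) = (\<Prod>i<d. b i - a i)"
proof -
  interpret product_prob_space "\<lambda>_. unit_interval_measure" "{..<d}"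
    by (intro product_prob_spaceI prob_space_unit_interval_measure)
  have "emeasure (cube_measure d) (box_event d a b)
      = (\<Prod>i<d. emeasure unit_interval_measure {a i..<b i})"
    unfolding box_event_def by (rule emeasure_PiM_Collect) auto
  also have "\<dots> = (\<Prod>i<d. ennreal (b i - a i))"
  proof (rule prod.cong[OF refl])
    fix i assume "i \<in> {..<d}"
    then have i: "0 \<le> a i" "a i \<le> b i" "b i \<le> 1" using assms by auto
    then have "{0..1} \<inter> {a i..<b i} = {a i..<b i}" by auto
    then show "emeasure unit_interval_measure {a i..<b i} = ennreal (b i - a i)"
      using i by (simp add: divide_ennreal_def)
  qed
  also have "\<dots> = ennreal (\<Prod>i<d. b i - a i)"
    using assms by (intro prod_ennreal) auto
  finally have "emeasure (cube_measure d) (box_event d a b) = ennreal (\<Prod>i<d. b i - a i)" .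
  moreover have "0 \<le> (\<Prod>i<d. b i - a i)" using assms by (intro prod_nonneg) auto
  ultimately show ?thesis by (simp add: measure_def)
qed

text \<open>Markov's inequality for \<open>exp (- count)\<close>, whose expectation factorises.\<close>

lemma count_lower_tail:
  fixes P :: "'a measure" and n :: nat
  assumes "prob_space P" and A: "A \<in> sets P"
  defines "M \<equiv> PiM {..<n} (\<lambda>_. P)"
  shows "{\<omega> \<in> space M. real (card {j \<in> {..<n}. \<omega> j \<in> A}) < real n * measure P A / 4} \<in> sets M"
    and "measure M {\<omega> \<in> space M. real (card {j \<in> {..<n}. \<omega> j \<in> A}) < real n * measure P A / 4}
           \<le> exp (- (real n * measure P A / 4))"
proof -
  define p where "p = measure P A"
  interpret S: prob_space P by fact
  interpret product_prob_space "\<lambda>_. P" "{..<n}"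
    by (intro product_prob_spaceI) (rule assms)
  interpret M: prob_space M unfolding M_def by (rule prob_space_PiM) (rule assms)
  have card_eq: "real (card {j \<in> {..<n}. \<omega> j \<in> A}) = (\<Sum>j<n. indicator A (\<omega> j))" for \<omega> :: "nat \<Rightarrow> 'a"
  proof -
    have "(\<Sum>j<n. indicator A (\<omega> j) :: real) = (\<Sum>j\<in>{j \<in> {..<n}. \<omega> j \<in> A}. 1)"
      by (rule sum.mono_neutral_cong_right) (auto simp: indicator_def)
    then show ?thesis by simp
  qed
  have [measurable]: "A \<in> sets P" by fact
  have meas [measurable]: "(\<lambda>\<omega>. \<Sum>j<n. indicator A (\<omega> j) :: real) \<in> borel_measurable M"
    unfolding M_def by measurable
  show "{\<omega> \<in> space M. real (card {j \<in> {..<n}. \<omega> j \<in> A}) < real n * measure P A / 4} \<in> sets M"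
    unfolding card_eq by measurable
  define u where "u \<omega> = (\<Prod>j<n. exp (- indicator A (\<omega> j)) :: real)" for \<omega> :: "nat \<Rightarrow> 'a"
  have u: "u \<omega> = exp (- (\<Sum>j<n. indicator A (\<omega> j)))" for \<omega>
    by (simp add: u_def exp_sum flip: sum_negf)
  have int_single: "integrable P (\<lambda>x. exp (- indicator A x) :: real)"
    by (rule S.integrable_const_bound[of _ 1]) auto
  have "(\<integral>x. exp (- indicator A x) \<partial>P) = (\<integral>x. 1 - (1 - exp (-1)) * indicator A x \<partial>P)"
    by (intro Bochner_Integration.integral_cong) (auto simp: indicator_def)
  also have "\<dots> = 1 - (1 - exp (-1)) * p"
    using S.integrable_const_bound[of "indicator A :: _ \<Rightarrow> real" 1] by (simp add: p_def S.prob_space)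
  \<comment> \<open>Bounding \<open>exp (-1)\<close> by 1/2 leaves decay \<open>p / 2\<close> per
    point, in total \<open>n * p / 2\<close>; Markov's inequality at the level
    \<open>n * p / 4\<close> gives back half of it.\<close>
  also have "\<dots> \<le> 1 - p / 2"
  proof -
    have "exp (-1) \<le> (1 / 2 :: real)"
      using exp_ge_add_one_self[of 1] by (simp add: exp_minus field_simps)
    then have "1 / 2 * p \<le> (1 - exp (-1)) * p" by (intro mult_right_mono) (auto simp: p_def)
    then show ?thesis by simp
  qed
  also have "\<dots> \<le> exp (- (p / 2))" using exp_ge_add_one_self[of "- (p / 2)"] by simp
  finally have single: "(\<integral>x. exp (- indicator A x) \<partial>P) \<le> exp (- (p / 2))" .
  have "(\<integral>\<omega>. u \<omega> \<partial>M) = (\<Prod>j<n. \<integral>x. exp (- indicator A x) \<partial>P)"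
    unfolding u_def M_def by (rule product_integral_prod) (auto intro: int_single)
  also have "\<dots> \<le> (\<Prod>j<n. exp (- (p / 2)))"
    by (rule prod_mono) (auto intro!: single integral_nonneg)
  also have "\<dots> = exp (- (real n * p / 2))" by (simp add: exp_of_nat_mult[symmetric])
  finally have Eu: "(\<integral>\<omega>. u \<omega> \<partial>M) \<le> exp (- (real n * p / 2))" .
  have "{\<omega> \<in> space M. real (card {j \<in> {..<n}. \<omega> j \<in> A}) < real n * p / 4}
      \<subseteq> {\<omega> \<in> space M. exp (- (real n * p / 4)) \<le> u \<omega>}"
    unfolding card_eq u by auto
  then have "measure M {\<omega> \<in> space M. real (card {j \<in> {..<n}. \<omega> j \<in> A}) < real n * p / 4}
      \<le> measure M {\<omega> \<in> space M. exp (- (real n * p / 4)) \<le> u \<omega>}"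
    by (rule M.finite_measure_mono) (unfold u, measurable)
  also have "\<dots> \<le> (\<integral>\<omega>. u \<omega> \<partial>M) / exp (- (real n * p / 4))"
  proof (rule integral_Markov_inequality_measure[where A = "space M"])
    show "integrable M u"
      unfolding u by (rule M.integrable_const_bound[of _ 1]) (auto simp: sum_nonneg)
  qed (auto simp: u)
  also have "\<dots> \<le> exp (- (real n * p / 2)) / exp (- (real n * p / 4))"
    using Eu by (intro divide_right_mono) auto
  also have "\<dots> = exp (- (real n * p / 4))"
    by (simp add: exp_diff[symmetric])
  finally show "measure M {\<omega> \<in> space M. real (card {j \<in> {..<n}. \<omega> j \<in> A}) < real n * measure P A / 4}
      \<le> exp (- (real n * measure P A / 4))"
    by (simp add: p_def)
qed

section \<open>Measurability of the copy event\<close>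

lemma measurable_eucl_dist:
  assumes "a < n" "b < n"
  shows "(\<lambda>\<omega>. eucl_dist d (\<omega> a) (\<omega> b)) \<in> borel_measurable (rgg_space d n)"
proof -
  have [measurable]: "(\<lambda>\<omega>. \<omega> j i) \<in> borel_measurable (rgg_space d n)" if "j < n" "i < d" for j i
  proof -
    have "(\<lambda>\<omega>. \<omega> j) \<in> measurable (rgg_space d n) (cube_measure d)"
      unfolding rgg_space_def by (rule measurable_component_singleton) (use that in simp)
    moreover have "(\<lambda>x. x i) \<in> measurable (cube_measure d) unit_interval_measure"
      by (rule measurable_component_singleton) (use that in simp)
    ultimately have "(\<lambda>\<omega>. \<omega> j i) \<in> measurable (rgg_space d n) unit_interval_measure"
      by (rule measurable_compose)
    then show ?thesis by (simp cong: measurable_cong_sets)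
  qed
  have "(\<lambda>\<omega>. \<Sum>i<d. (\<omega> a i - \<omega> b i)^2) \<in> borel_measurable (rgg_space d n)"
    using assms by (intro borel_measurable_sum borel_measurable_power borel_measurable_diff) auto
  then show ?thesis unfolding eucl_dist_def by measurable
qed

text \<open>Restricting the embedding to \<open>V\<close> leaves only finitely many candidates when
  \<open>V\<close> is finite, so the event becomes a finite union of measurable ones.\<close>

lemma rgg_contains_copy_iff_PiE:
  "rgg_contains_copy d n r V E \<omega> \<longleftrightarrow>
     (\<exists>f\<in>PiE V (\<lambda>_. {..<n}). inj_on f V \<and>
        (\<forall>u\<in>V. \<forall>v\<in>V. E u v \<longrightarrow> eucl_dist d (\<omega> (f u)) (\<omega> (f v)) \<le> r))" (is "?L \<longleftrightarrow> ?R")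
proof
  assume ?L
  then obtain f where "inj_on f V" "f ` V \<subseteq> {..<n}"
    "\<forall>u\<in>V. \<forall>v\<in>V. E u v \<longrightarrow> eucl_dist d (\<omega> (f u)) (\<omega> (f v)) \<le> r"
    unfolding rgg_contains_copy_def by blast
  then show ?R by (intro bexI[of _ "restrict f V"]) auto
next
  assume ?R
  then show ?L unfolding rgg_contains_copy_def by (fastforce simp: PiE_iff)
qed

lemma sets_rgg_contains_copy:
  assumes "finite V"
  shows "{\<omega> \<in> space (rgg_space d n). rgg_contains_copy d n r V E \<omega>} \<in> sets (rgg_space d n)"
  unfolding rgg_contains_copy_iff_PiE
proof (intro sets.sets_Collect_finite_Ex sets.sets_Collect_conj sets.sets_Collect_finite_All
    sets.sets_Collect_imp sets.sets_Collect_const finite_PiE assms)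
  fix f u v assume "f \<in> PiE V (\<lambda>_. {..<n})" "u \<in> V" "v \<in> V"
  then have "f u < n" "f v < n" by auto
  from measurable_eucl_dist[OF this]
  show "{\<omega> \<in> space (rgg_space d n). eucl_dist d (\<omega> (f u)) (\<omega> (f v)) \<le> r} \<in> sets (rgg_space d n)"
    by measurable
qed auto

text \<open>The sample space allows arbitrary real coordinates and the cells omit the upper faces of
  the cube; this discards the remaining points as a null set.\<close>

lemma measure_points_in_unit_cube:
  "measure (rgg_space d n) {\<omega> \<in> space (rgg_space d n). \<forall>j\<in>{..<n}. \<omega> j \<in> box_event d (\<lambda>_. 0) (\<lambda>_. 1)} = 1"
proof -
  interpret C: prob_space "cube_measure d" by (rule prob_space_cube_measure)
  interpret product_prob_space "\<lambda>_. cube_measure d" "{..<n}"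
    by (intro product_prob_spaceI prob_space_cube_measure)
  have "emeasure (cube_measure d) (box_event d (\<lambda>_. 0) (\<lambda>_. 1)) = 1"
    by (simp add: C.emeasure_eq_measure measure_box_event)
  then have "emeasure (rgg_space d n)
      {\<omega> \<in> space (rgg_space d n). \<forall>j\<in>{..<n}. \<omega> j \<in> box_event d (\<lambda>_. 0) (\<lambda>_. 1)} = 1"
    unfolding rgg_space_def by (subst emeasure_PiM_Collect) auto
  then show ?thesis by (simp add: measure_def)
qed

section \<open>Probability bounds on the two sides of the threshold\<close>

text \<open>Union bound over the \<open>N ^ d\<close> cells: each expects \<open>n / N ^ d\<close>
  points and fails to get a quarter of them with exponentially small probability. If none fails, the
  deterministic embedding applies.\<close>

lemma rgg_prob_bal_tree_ge:
  fixes s :: "nat \<Rightarrow> nat" and h n k N d :: nat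
  assumes N: "0 < N" and s: "\<forall>i\<in>{1..h}. 2 \<le> s i" and k: "2 * k < h"
    and n: "n = card (bal_verts s h)" and Nk: "12 * N ^ d \<le> 2 ^ k"
    and r: "sqrt (real d) * (1 / (2 * (real h - 2 * real k)) + 3 / real N) \<le> r"
  shows "rgg_prob d n r (bal_verts s h) (bal_edge s h)
    \<ge> 1 - real (N ^ d) * exp (- (real n / (4 * real (N ^ d))))"
proof -
  interpret prob_space "rgg_space d n" by (rule prob_space_rgg_space)
  define a where "a u i = real (snake N u i) / real N" for u i
  define b where "b u i = (real (snake N u i) + 1) / real N" for u i
  define p where "p = 1 / real (N ^ d)"
  define Good where "Good = {\<omega> \<in> space (rgg_space d n). rgg_contains_copy d n r (bal_verts s h) (bal_edge s h) \<omega>}"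
  define Bad where "Bad u = {\<omega> \<in> space (rgg_space d n).
      real (card {j \<in> {..<n}. \<omega> j \<in> box_event d (a u) (b u)}) < real n * p / 4}" for u
  have p: "measure (cube_measure d) (box_event d (a u) (b u)) = p" for u
  proof -
    have "0 \<le> a u i \<and> a u i \<le> b u i \<and> b u i \<le> 1" for i
    proof -
      have "snake N u i < N" using N by (simp add: snake_def zigzag_less)
      then show ?thesis using N by (auto simp: a_def b_def divide_simps)
    qed
    then have "measure (cube_measure d) (box_event d (a u) (b u)) = (\<Prod>i<d. b u i - a u i)"
      by (intro measure_box_event) auto
    also have "\<dots> = p" by (simp add: a_def b_def p_def power_divide flip: diff_divide_distrib)
    finally show ?thesis .
  qed
  have Bad: "Bad u \<in> events" "prob (Bad u) \<le> exp (- (real n * p / 4))" for u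
    using count_lower_tail[OF prob_space_cube_measure sets_box_event[of d "a u" "b u"], of n]
    unfolding Bad_def rgg_space_def p by blast+
  have Good: "Good \<in> events" unfolding Good_def by (rule sets_rgg_contains_copy) simp
  have "{\<omega> \<in> space (rgg_space d n). \<forall>j\<in>{..<n}. \<omega> j \<in> box_event d (\<lambda>_. 0) (\<lambda>_. 1)}
      \<subseteq> Good \<union> (\<Union>u\<in>{..<N ^ d}. Bad u)"
  proof
    fix \<omega> assume \<omega>: "\<omega> \<in> {\<omega> \<in> space (rgg_space d n). \<forall>j\<in>{..<n}. \<omega> j \<in> box_event d (\<lambda>_. 0) (\<lambda>_. 1)}"
    then have \<omega>_sp: "\<omega> \<in> space (rgg_space d n)"
      and cube: "\<And>j. j < n \<Longrightarrow> \<forall>i<d. 0 \<le> \<omega> j i \<and> \<omega> j i < 1"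
      and sp: "\<And>j. j < n \<Longrightarrow> \<omega> j \<in> space (cube_measure d)"
      by (auto simp: box_event_def)
    show "\<omega> \<in> Good \<union> (\<Union>u\<in>{..<N ^ d}. Bad u)"
    proof (cases "\<exists>u<N ^ d. \<omega> \<in> Bad u")
      case True
      then show ?thesis by auto
    next
      case False
      have "rgg_contains_copy d n r (bal_verts s h) (bal_edge s h) \<omega>"
      proof (rule contains_copy_of_cell_counts[OF N s k n cube _ r])
        fix u assume u: "u < N ^ d"
        define c where "c = card {j \<in> {..<n}. in_cell N d u (\<omega> j)}"
        have "{j \<in> {..<n}. \<omega> j \<in> box_event d (a u) (b u)} = {j \<in> {..<n}. in_cell N d u (\<omega> j)}"
          using sp by (auto simp: box_event_def in_cell_def a_def b_def)
        moreover have "\<omega> \<notin> Bad u" using False u by blast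
        ultimately have "real n * p / 4 \<le> real c"
          using \<omega>_sp unfolding Bad_def c_def by (simp only: mem_Collect_eq not_less simp_thms)
        then have "real n \<le> real c * (4 * real (N ^ d))"
          using N by (simp add: p_def field_simps)
        then have "n \<le> c * (4 * N ^ d)" by (subst of_nat_le_iff[where 'a = real, symmetric]) simp
        \<comment> \<open>The constant 12 is 3 times 4: the factor 3 required by the cell
          assignment, and the quarter lost in the tail bound.\<close>
        then have "3 * n \<le> c * (12 * N ^ d)" by simp
        also have "\<dots> \<le> c * 2 ^ k" using Nk by (rule mult_le_mono2)
        finally show "3 * n \<le> card {j \<in> {..<n}. in_cell N d u (\<omega> j)} * 2 ^ k" by (simp add: c_def)
      qed
      then show ?thesis using \<omega>_sp by (simp add: Good_def)
    qed
  qed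
  moreover have "Good \<union> (\<Union>u\<in>{..<N ^ d}. Bad u) \<in> events"
    using Good Bad by (intro sets.Un sets.finite_UN) auto
  ultimately have "1 \<le> prob (Good \<union> (\<Union>u\<in>{..<N ^ d}. Bad u))"
    by (subst measure_points_in_unit_cube[of d n, symmetric]) (rule finite_measure_mono)
  also have "\<dots> \<le> prob Good + prob (\<Union>u\<in>{..<N ^ d}. Bad u)"
    using Good Bad by (intro measure_Un_le) auto
  also have "prob (\<Union>u\<in>{..<N ^ d}. Bad u) \<le> (\<Sum>u\<in>{..<N ^ d}. prob (Bad u))"
    using Bad by (intro measure_UNION_le) auto
  also have "\<dots> \<le> (\<Sum>u\<in>{..<N ^ d}. exp (- (real n * p / 4)))"
    using Bad by (intro sum_mono) auto
  also have "\<dots> = real (N ^ d) * exp (- (real n / (4 * real (N ^ d))))"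
    by (simp add: p_def mult.commute)
  finally show ?thesis by (simp add: Good_def rgg_prob_def)
qed

lemma eucl_dist_triangle: "eucl_dist d x z \<le> eucl_dist d x y + eucl_dist d y z"
proof -
  have "eucl_dist d x z = L2_set (\<lambda>i. (x i - y i) + (y i - z i)) {..<d}"
    by (simp add: eucl_dist_def L2_set_def)
  also have "\<dots> \<le> eucl_dist d x y + eucl_dist d y z"
    unfolding eucl_dist_def L2_set_def[symmetric] by (rule L2_set_triangle_ineq)
  finally show ?thesis .
qed

text \<open>There are as many points as vertices, so the injection \<open>f\<close> is onto and
  every point represents a vertex. Two vertices are joined through the root by at most
  \<open>2 * h\<close> edges.\<close>

lemma bal_tree_copy_dist:
  assumes V: "V = bal_verts s h"
    and f: "f ` V \<subseteq> {..<card V}" "inj_on f V"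
    and edge: "\<And>u v. u \<in> V \<Longrightarrow> v \<in> V \<Longrightarrow> bal_edge s h u v \<Longrightarrow> eucl_dist d (\<omega> (f u)) (\<omega> (f v)) \<le> R"
    and R: "0 \<le> R" and ij: "i < card V" "j < card V"
  shows "eucl_dist d (\<omega> i) (\<omega> j) \<le> 2 * real h * R"
proof -
  have len: "eucl_dist d (\<omega> (f [])) (\<omega> (f xs)) \<le> real (length xs) * R" if "xs \<in> V" for xs
    using that
  proof (induction xs rule: rev_induct)
    case Nil
    then show ?case by (simp add: eucl_dist_def)
  next
    case (snoc a xs)
    have xs: "xs \<in> V" using snoc.prems by (auto simp: V bal_verts_def nth_append split: if_splits)
    have "eucl_dist d (\<omega> (f xs)) (\<omega> (f (xs @ [a]))) \<le> R"
      using xs snoc.prems by (intro edge) (auto simp: bal_edge_def V)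
    with snoc.IH[OF xs] eucl_dist_triangle[of d "\<omega> (f [])" "\<omega> (f (xs @ [a]))" "\<omega> (f xs)"]
    show ?case by (simp add: algebra_simps)
  qed
  have root: "eucl_dist d (\<omega> (f [])) (\<omega> (f xs)) \<le> real h * R" if "xs \<in> V" for xs
  proof -
    have "length xs \<le> h" using that by (simp add: V bal_verts_def)
    then have "real (length xs) * R \<le> real h * R" using R by (intro mult_right_mono) auto
    with len[OF that] show ?thesis by simp
  qed
  have "f ` V = {..<card V}"
    using f card_image[OF f(2)] by (intro card_subset_eq) auto
  then obtain xs ys where "xs \<in> V" "ys \<in> V" "i = f xs" "j = f ys"
    using ij by (metis imageE lessThan_iff)
  with root[of xs] root[of ys] eucl_dist_triangle[of d "\<omega> i" "\<omega> j" "\<omega> (f [])"]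
  show ?thesis by (simp add: eucl_dist_commute)
qed

text \<open>Points in opposite corner boxes of side \<open>\<delta>\<close> differ by more than
  \<open>1 - 2 * \<delta>\<close> in every coordinate, too far apart for a copy. The bound
  \<open>R\<close> is kept separate from \<open>r\<close> because \<open>r\<close> may be
  negative.\<close>

lemma rgg_prob_bal_tree_le:
  fixes s :: "nat \<Rightarrow> nat" and h n d :: nat and r R \<delta> :: real
  assumes n: "n = card (bal_verts s h)" and \<delta>: "0 < \<delta>" "\<delta> \<le> 1 / 2"
    and r: "r \<le> R" "0 \<le> R" and R: "2 * real h * R < sqrt (real d) * (1 - 2 * \<delta>)"
  shows "rgg_prob d n r (bal_verts s h) (bal_edge s h) \<le> 2 * exp (- (real n * \<delta> ^ d / 4))"
proof -
  interpret prob_space "rgg_space d n" by (rule prob_space_rgg_space)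
  define A where "A = box_event d (\<lambda>_. 0) (\<lambda>_. \<delta>)"
  define B where "B = box_event d (\<lambda>_. 1 - \<delta>) (\<lambda>_. 1)"
  define bad where "bad X = {\<omega> \<in> space (rgg_space d n).
      real (card {j \<in> {..<n}. \<omega> j \<in> X}) < real n * \<delta> ^ d / 4}" for X
  have AB: "measure (cube_measure d) A = \<delta> ^ d" "measure (cube_measure d) B = \<delta> ^ d"
    unfolding A_def B_def using \<delta> by (simp_all add: measure_box_event)
  have ABs: "A \<in> sets (cube_measure d)" "B \<in> sets (cube_measure d)"
    by (simp_all add: A_def B_def sets_box_event)
  have bad: "bad A \<in> events" "bad B \<in> events"
      "prob (bad A) \<le> exp (- (real n * \<delta> ^ d / 4))" "prob (bad B) \<le> exp (- (real n * \<delta> ^ d / 4))"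
    using count_lower_tail[OF prob_space_cube_measure ABs(1), where n = n]
      count_lower_tail[OF prob_space_cube_measure ABs(2), where n = n]
    unfolding bad_def rgg_space_def AB by blast+
  \<comment> \<open>A positive threshold means that a box that is not bad contains at least one
    point.\<close>
  have "0 < real n * \<delta> ^ d / 4" using \<delta> card_bal_verts_pos[of s h] by (simp add: n)
  then have hit: "\<exists>j<n. \<omega> j \<in> X" if "\<omega> \<in> space (rgg_space d n)" "\<omega> \<notin> bad X" for \<omega> X
  proof -
    have "0 < card {j \<in> {..<n}. \<omega> j \<in> X}"
      using that \<open>0 < real n * \<delta> ^ d / 4\<close> unfolding bad_def by (auto simp: not_less)
    then show ?thesis by (auto simp: card_gt_0_iff)
  qed
  have "{\<omega> \<in> space (rgg_space d n). rgg_contains_copy d n r (bal_verts s h) (bal_edge s h) \<omega>} \<subseteq> bad A \<union> bad B"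
  proof (rule subsetI, rule ccontr)
    fix \<omega>
    assume \<omega>: "\<omega> \<in> {\<omega> \<in> space (rgg_space d n). rgg_contains_copy d n r (bal_verts s h) (bal_edge s h) \<omega>}"
      and "\<omega> \<notin> bad A \<union> bad B"
    then obtain i j where ij: "i < n" "\<omega> i \<in> A" "j < n" "\<omega> j \<in> B"
      using hit[of \<omega> A] hit[of \<omega> B] by auto
    from \<omega> obtain f where f: "inj_on f (bal_verts s h)" "f ` bal_verts s h \<subseteq> {..<n}"
      and edge: "\<forall>u\<in>bal_verts s h. \<forall>v\<in>bal_verts s h. bal_edge s h u v \<longrightarrow> eucl_dist d (\<omega> (f u)) (\<omega> (f v)) \<le> r"
      unfolding rgg_contains_copy_def by auto
    have "eucl_dist d (\<omega> i) (\<omega> j) \<le> 2 * real h * R"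
      using f edge r ij by (intro bal_tree_copy_dist[OF refl]) (auto simp: n intro: order_trans)
    moreover have "sqrt (real d) * (1 - 2 * \<delta>) \<le> eucl_dist d (\<omega> i) (\<omega> j)"
    proof -
      have "(1 - 2 * \<delta>)^2 \<le> (\<omega> i l - \<omega> j l)^2" if "l < d" for l
      proof -
        have "\<omega> i l < \<delta>" "1 - \<delta> \<le> \<omega> j l" using ij that by (auto simp: A_def B_def box_event_def)
        then have "(1 - 2 * \<delta>)^2 \<le> (\<omega> j l - \<omega> i l)^2" using \<delta> by (intro power_mono) auto
        then show ?thesis by (simp add: power2_commute)
      qed
      then have "(\<Sum>l<d. (1 - 2 * \<delta>)^2) \<le> (\<Sum>l<d. (\<omega> i l - \<omega> j l)^2)"
        by (intro sum_mono) auto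
      then have "sqrt (real d * (1 - 2 * \<delta>)^2) \<le> eucl_dist d (\<omega> i) (\<omega> j)"
        unfolding eucl_dist_def by simp
      then show ?thesis using \<delta> by (simp add: real_sqrt_mult)
    qed
    ultimately show False using R by linarith
  qed
  then have "rgg_prob d n r (bal_verts s h) (bal_edge s h) \<le> prob (bad A \<union> bad B)"
    unfolding rgg_prob_def using bad by (intro finite_measure_mono) auto
  also have "\<dots> \<le> prob (bad A) + prob (bad B)"
    using bad by (intro measure_Un_le) auto
  finally show ?thesis using bad by linarith
qed

section \<open>The sharp threshold\<close>

lemma grid_cells_le_exponential:
  fixes \<delta> :: real and K d :: nat
  assumes "0 < \<delta>"
  shows "eventually (\<lambda>h. 12 * (K * h) ^ d \<le> 2 ^ nat \<lfloor>\<delta> * real h\<rfloor>) at_top"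
proof -
  have "eventually (\<lambda>h::nat. 12 * real K ^ d * real h powr real d \<le> 2 powr (\<delta> * real h - 1)) at_top"
    using assms by real_asymp
  with eventually_gt_at_top[of "0::nat"] show ?thesis
  proof eventually_elim
    case (elim h)
    have "real (12 * (K * h) ^ d) = 12 * real K ^ d * real h powr real d"
      using elim(1) by (simp add: powr_realpow power_mult_distrib)
    also have "\<dots> \<le> 2 powr (\<delta> * real h - 1)" by (rule elim)
    \<comment> \<open>Rounding down loses at most one, which is the \<open>- 1\<close> in the
      exponent.\<close>
    also have "\<dots> \<le> 2 powr real (nat \<lfloor>\<delta> * real h\<rfloor>)"
      by (rule powr_mono) linarith+
    also have "\<dots> = real (2 ^ nat \<lfloor>\<delta> * real h\<rfloor>)" by (simp add: powr_realpow)
    finally show ?case by (simp only: of_nat_le_iff)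
  qed
qed

text \<open>The slack \<open>\<epsilon>\<close> is spent in two halves: the \<open>2 * k\<close>
  levels without motion cost a factor of at most \<open>1 + \<epsilon> / 2\<close>, and the three
  cell sides of length \<open>1 / (K * h)\<close> fit into the other half.\<close>

lemma step_length_bound:
  fixes \<epsilon> :: real and h k K d :: nat
  assumes \<epsilon>: "0 < \<epsilon>" "\<epsilon> < 1" and h: "0 < h" and k: "real k \<le> \<epsilon> / 16 * real h" and K: "64 / \<epsilon> \<le> real K"
  shows "sqrt (real d) * (1 / (2 * (real h - 2 * real k)) + 3 / real (K * h)) \<le> (1 + \<epsilon>) * rstar d h"
proof -
  have hk: "(1 - \<epsilon> / 8) * real h \<le> real h - 2 * real k" using k by (simp add: algebra_simps)
  have "1 \<le> (1 + \<epsilon> / 2) * (1 - \<epsilon> / 8)"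
  proof -
    have "\<epsilon> * \<epsilon> \<le> \<epsilon> * 1" using \<epsilon> by (intro mult_left_mono) auto
    then show ?thesis using \<epsilon> by (simp add: algebra_simps)
  qed
  then have "1 * real h \<le> (1 + \<epsilon> / 2) * (1 - \<epsilon> / 8) * real h" by (rule mult_right_mono) simp
  also have "\<dots> \<le> (1 + \<epsilon> / 2) * (real h - 2 * real k)"
    using mult_left_mono[OF hk, of "1 + \<epsilon> / 2"] \<epsilon> by (simp add: mult.assoc)
  finally have *: "real h \<le> (1 + \<epsilon> / 2) * (real h - 2 * real k)" by simp
  have "0 < (1 - \<epsilon> / 8) * real h" using \<epsilon> h by simp
  with hk have pos: "0 < real h - 2 * real k" by linarith
  have 1: "1 / (2 * (real h - 2 * real k)) \<le> (1 + \<epsilon> / 2) / (2 * real h)"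
    using * pos h by (simp add: field_simps)
  have "0 < 64 / \<epsilon>" using \<epsilon> by simp
  then have "0 < real K" using K by linarith
  have "3 / real K \<le> \<epsilon> / 4"
  proof -
    have "64 \<le> real K * \<epsilon>" using K \<epsilon> by (simp add: field_simps)
    then have "12 \<le> real K * \<epsilon>" by simp
    then show ?thesis using \<open>0 < real K\<close> by (simp add: field_simps)
  qed
  then have 2: "3 / real (K * h) \<le> (\<epsilon> / 2) / (2 * real h)"
    using h \<open>0 < real K\<close> by (simp add: field_simps)
  have "1 / (2 * (real h - 2 * real k)) + 3 / real (K * h) \<le> (1 + \<epsilon>) / (2 * real h)"
  proof -
    have "(1 + \<epsilon> / 2) / (2 * real h) + \<epsilon> / 2 / (2 * real h) = (1 + \<epsilon>) / (2 * real h)"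
      using h by (simp add: field_simps)
    with add_mono[OF 1 2] show ?thesis by (simp only:)
  qed
  then have "sqrt (real d) * (1 / (2 * (real h - 2 * real k)) + 3 / real (K * h))
      \<le> sqrt (real d) * ((1 + \<epsilon>) / (2 * real h))"
    by (rule mult_left_mono) simp
  then show ?thesis by (simp add: rstar_def mult.commute)
qed

lemma rgg_prob_supercritical:
  fixes d :: nat and s :: "nat \<Rightarrow> nat \<Rightarrow> nat" and \<epsilon> :: real and r :: "nat \<Rightarrow> real"
  assumes "0 < d" and s: "\<And>h. 1 \<le> h \<Longrightarrow> \<forall>i\<in>{1..h}. 2 \<le> s h i" and \<epsilon>: "0 < \<epsilon>" "\<epsilon> < 1"
    and r: "\<And>h. (1 + \<epsilon>) * rstar d h \<le> r h"
  shows "(\<lambda>h. rgg_prob d (card (bal_verts (s h) h)) (r h) (bal_verts (s h) h) (bal_edge (s h) h)) \<longlonglongrightarrow> 1"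
proof -
  define K where "K = nat \<lceil>64 / \<epsilon>\<rceil>"
  have K: "64 / \<epsilon> \<le> real K" unfolding K_def by linarith
  have "0 < 64 / \<epsilon>" using \<epsilon> by simp
  with K have "0 < real K" by linarith
  then have K0: "0 < K" by simp
  define p where "p h = rgg_prob d (card (bal_verts (s h) h)) (r h) (bal_verts (s h) h) (bal_edge (s h) h)" for h
  have "eventually (\<lambda>h. 12 * (K * h) ^ d \<le> 2 ^ nat \<lfloor>\<epsilon> / 16 * real h\<rfloor>) at_top"
    using \<epsilon> by (intro grid_cells_le_exponential) auto
  with eventually_gt_at_top[of "0::nat"]
  have lower: "eventually (\<lambda>h. 1 - 2 / real h \<le> p h) at_top"
  proof eventually_elim
    case (elim h)
    define k where "k = nat \<lfloor>\<epsilon> / 16 * real h\<rfloor>"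
    define m where "m = (K * h) ^ d"
    define n where "n = card (bal_verts (s h) h)"
    have sh: "\<forall>i\<in>{1..h}. 2 \<le> s h i" using s elim by auto
    have k: "real k \<le> \<epsilon> / 16 * real h" using \<epsilon> unfolding k_def by (intro of_nat_floor) simp
    also have "\<dots> \<le> 1 / 16 * real h" using \<epsilon> by (intro mult_right_mono) auto
    finally have kh: "2 * k < h" using elim(1) by linarith
    have mk: "12 * m \<le> 2 ^ k" using elim(2) by (simp add: m_def k_def)
    have hm: "h \<le> m"
    proof -
      have "h \<le> K * h" using K0 by simp
      also have "\<dots> \<le> (K * h) ^ d" using \<open>0 < d\<close> K0 elim(1) by (intro self_le_power) auto
      finally show ?thesis by (simp add: m_def)
    qed
    have mn: "4 * m * m \<le> n"
    proof -
      have "4 * m * m \<le> (12 * m) * (12 * m)" by simp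
      also have "\<dots> \<le> 2 ^ k * 2 ^ k" using mk by (intro mult_le_mono)
      also have "\<dots> = 2 ^ (2 * k)" by (simp add: mult_2 power_add)
      also have "\<dots> \<le> 2 ^ h" using kh by (intro power_increasing) auto
      also have "\<dots> \<le> n" unfolding n_def by (rule card_bal_verts_ge[OF sh])
      finally show ?thesis .
    qed
    have m0: "0 < real m" using hm elim(1) by simp
    have "real m \<le> real n / (4 * real m)"
    proof -
      have "4 * real m * real m \<le> real n"
        using of_nat_mono[OF mn, where 'a = real] by simp
      then show ?thesis using m0 by (simp add: field_simps)
    qed
    then have "real m * exp (- (real n / (4 * real m))) \<le> real m * exp (- real m)" using m0 by simp
    also have "\<dots> \<le> 2 / real m"
    proof -
      have "real m ^ 2 / 2 \<le> exp (real m)"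
        using exp_lower_Taylor_quadratic[of "real m"] m0 by simp
      then show ?thesis using m0 by (simp add: exp_minus field_simps power2_eq_square)
    qed
    also have "\<dots> \<le> 2 / real h" using hm elim(1) by (intro divide_left_mono) auto
    finally have "real m * exp (- (real n / (4 * real m))) \<le> 2 / real h" .
    moreover have "1 - real m * exp (- (real n / (4 * real m))) \<le> p h"
      unfolding p_def m_def n_def
    proof (rule rgg_prob_bal_tree_ge[OF _ sh kh refl])
      show "0 < K * h" using K0 elim(1) by simp
      show "12 * (K * h) ^ d \<le> 2 ^ k" using mk by (simp add: m_def)
      show "sqrt (real d) * (1 / (2 * (real h - 2 * real k)) + 3 / real (K * h)) \<le> r h"
        using step_length_bound[OF \<epsilon> elim(1) k K, of d] r[of h] by linarith
    qed
    ultimately show ?case by linarith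
  qed
  have upper: "p h \<le> 1" for h
    unfolding p_def rgg_prob_def by (rule prob_space.prob_le_1[OF prob_space_rgg_space])
  have lim: "(\<lambda>h. 1 - 2 / real h) \<longlonglongrightarrow> 1" by real_asymp
  have "p \<longlonglongrightarrow> 1"
    by (rule tendsto_sandwich[OF lower _ lim tendsto_const]) (simp add: upper)
  then show ?thesis unfolding p_def[abs_def] .
qed

lemma rgg_prob_subcritical:
  fixes d :: nat and s :: "nat \<Rightarrow> nat \<Rightarrow> nat" and \<epsilon> :: real and r :: "nat \<Rightarrow> real"
  assumes "0 < d" and s: "\<And>h. 1 \<le> h \<Longrightarrow> \<forall>i\<in>{1..h}. 2 \<le> s h i" and \<epsilon>: "0 < \<epsilon>" "\<epsilon> < 1"
    and r: "\<And>h. r h \<le> (1 - \<epsilon>) * rstar d h"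
  shows "(\<lambda>h. rgg_prob d (card (bal_verts (s h) h)) (r h) (bal_verts (s h) h) (bal_edge (s h) h)) \<longlonglongrightarrow> 0"
proof -
  define \<delta> where "\<delta> = \<epsilon> / 4"
  define c where "c = \<delta> ^ d / 4"
  have c: "0 < c" using \<epsilon> by (simp add: c_def \<delta>_def)
  define p where "p h = rgg_prob d (card (bal_verts (s h) h)) (r h) (bal_verts (s h) h) (bal_edge (s h) h)" for h
  have upper: "eventually (\<lambda>h. p h \<le> 2 * exp (- (real h * c))) at_top"
    using eventually_gt_at_top[of "0::nat"]
  proof eventually_elim
    case (elim h)
    define n where "n = card (bal_verts (s h) h)"
    have "p h \<le> 2 * exp (- (real n * \<delta> ^ d / 4))"
      unfolding p_def n_def
    proof (rule rgg_prob_bal_tree_le[OF refl _ _ r])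
      show "0 < \<delta>" "\<delta> \<le> 1 / 2" using \<epsilon> by (auto simp: \<delta>_def)
      show "0 \<le> (1 - \<epsilon>) * rstar d h" using \<epsilon> by (simp add: rstar_def)
      have "2 * real h * ((1 - \<epsilon>) * rstar d h) = sqrt (real d) * (1 - \<epsilon>)"
        using elim by (simp add: rstar_def)
      also have "\<dots> < sqrt (real d) * (1 - 2 * \<delta>)"
        using \<open>0 < d\<close> \<epsilon> by (simp add: \<delta>_def)
      finally show "2 * real h * ((1 - \<epsilon>) * rstar d h) < sqrt (real d) * (1 - 2 * \<delta>)" .
    qed
    also have "\<dots> \<le> 2 * exp (- (real h * c))"
    proof -
      have "h \<le> 2 ^ h" by simp
      also have "\<dots> \<le> n" unfolding n_def by (rule card_bal_verts_ge) (use s elim in auto)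
      finally have "real h * c \<le> real n * c" using c by (intro mult_right_mono) auto
      then show ?thesis by (simp add: c_def)
    qed
    finally show ?case .
  qed
  have lower: "0 \<le> p h" for h by (simp add: p_def rgg_prob_def)
  have lim: "(\<lambda>h. 2 * exp (- (real h * c))) \<longlonglongrightarrow> 0" using c by real_asymp
  have "p \<longlonglongrightarrow> 0"
    by (rule tendsto_sandwich[OF _ upper tendsto_const lim]) (simp add: lower)
  then show ?thesis unfolding p_def[abs_def] .
qed

theorem theorem1p2:
  fixes d :: nat and M :: "nat \<Rightarrow> nat" and s :: "nat \<Rightarrow> nat \<Rightarrow> nat" and \<epsilon> :: real
  assumes "0 < d"
    and "\<forall>h\<ge>1. 2 \<le> M h"
    and "(\<lambda>h. real (M h)) \<in> o(\<lambda>h. real h / ln (real h))"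
    and "\<forall>h\<ge>1. balanced_M_seq (M h) h (s h)"
    and "0 < \<epsilon>" and "\<epsilon> < 1"
  shows "(\<forall>r :: nat \<Rightarrow> real. (\<forall>h. r h \<le> (1 - \<epsilon>) * rstar d h) \<longrightarrow>
            (\<lambda>h. rgg_prob d (card (bal_verts (s h) h)) (r h) (bal_verts (s h) h) (bal_edge (s h) h))
              \<longlonglongrightarrow> 0)
       \<and> (\<forall>r :: nat \<Rightarrow> real. (\<forall>h. r h \<ge> (1 + \<epsilon>) * rstar d h) \<longrightarrow>
            (\<lambda>h. rgg_prob d (card (bal_verts (s h) h)) (r h) (bal_verts (s h) h) (bal_edge (s h) h))
              \<longlonglongrightarrow> 1)"
proof -
  have s: "\<forall>i\<in>{1..h}. 2 \<le> s h i" if "1 \<le> h" for h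
    using assms(4) that by (auto simp: balanced_M_seq_def)
  show ?thesis
    using rgg_prob_subcritical[OF assms(1) s assms(5,6)] rgg_prob_supercritical[OF assms(1) s assms(5,6)]
    by blast
qed

end
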